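(* (Parabolic strong maximum principle) Let $\Omega\subset\mathbb{R}^{n+1}$ (points $(x,t)$, $x\in\mathbb{R}^n$, $t\in\mathbb{R}$) be a bounded connected open set lying in $\{t<T\}$ for some $T$, and suppose that $\partial\Omega$ includes a relatively open subset $\Sigma$ of the hypersurface $\{t=T\}$. Let $F(x,t,s,p,M)$, defined for $(x,t)\in\overline\Omega$, $s\in\mathbb{R}$, $p\in\mathbb{R}^n$, $M\in\mathcal{S}^{n\times n}$, be continuous and of class $C^1$ in $(s,p,M)$, with $\big(\frac{\partial F}{\partial M_{ij}}\big)$ positive definite for all values of the arguments. Let $u\ge v$ be functions on $\overline\Omega$, with $u$ lower semicontinuous and $v\in C^2$, such that $$F(x,t,u,\nabla u,\nabla^2u)-u_t\le F(x,t,v,\nabla v,\nabla^2v)-v_t\quad\text{in }\Omega\cup\Sigma\text{ in the viscosity sense}.$$ If $u(P)=v(P)$ at a point $P$ on $\Sigma$, then $$u\equiv v\quad\text{in }C_P\cup S_P.$$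
   Context: $\nabla,\nabla^2$ denote first and second derivatives in the $x$-variables; $\mathcal{S}^{n\times n}$ is the set of real symmetric $n\times n$ matrices. "Of class $C^1$ in $(s,p,M)$" means the partial derivatives in $(s,p,M)$ exist and are continuous in all arguments. No uniform ellipticity and no uniform bounds on $|F_s|,|F_{p_i}|$ are assumed. For $P=(x_0,t_0)\in\Omega\cup\Sigma$: $C_P$ is the arcwise connected component, containing $P$, of the set of points of the form $(x,t_0)$ in $\Omega\cup\Sigma$ (so $C_P\subset\{t=t_0\}$); $S_P$ is the set of points $Q\in\Omega$ which can be connected to $P$ by a continuous curve in $\Omega\cup\Sigma$, from $Q$ to $P$, on which the $t$-coordinate is nondecreasing. Viscosity sense on $\Omega\cup\Sigma$: whenever $(x_0,t_0)\in\Omega\cup\Sigma$ and $\varphi$ is a $C^2$ function near $(x_0,t_0)$ with $\varphi\le u$ at the points of $\Omega\cup\Sigma$ near $(x_0,t_0)$ and $\varphi(x_0,t_0)=u(x_0,t_0)$, one has at $(x_0,t_0)$: $F(x_0,t_0,\varphi,\nabla\varphi,\nabla^2\varphi)-\varphi_t\le F(x_0,t_0,v,\nabla v,\nabla^2v)-v_t$.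
   Formalization: Σ is additionally required to be a genuine boundary portion: Ω∪Σ is relatively open in {t≤T}, i.e. Ω fills the side {t<T} near each point of Σ. With mere inclusion Σ⊂∂Ω the claim fails, e.g. for the heat operator when infinitely many slits of Ω accumulate at Σ. *)

theory Defs
  imports "HOL-Analysis.Analysis"
begin

text \<open>A point \<open>(x, t)\<close> of space-time has type \<^typ>\<open>(real ^ 'n) \<times> real\<close>; the space dimension is
  \<open>n = CARD('n)\<close>.\<close>

definition lower_semicontinuous_on :: "'a::topological_space set \<Rightarrow> ('a \<Rightarrow> real) \<Rightarrow> bool" where
  "lower_semicontinuous_on A u \<longleftrightarrow>
     (\<forall>z\<in>A. \<forall>c. c < u z \<longrightarrow> (\<forall>\<^sub>F w in at z within A. c < u w))"

text \<open>On \<open>\<Omega> \<union> \<Sigma>\<close>, near a point of \<open>\<Sigma>\<close>, the derivatives below are one-sided in \<open>t\<close>, so this is \<open>C\<^sup>2\<close>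
  up to the boundary portion \<open>\<Sigma>\<close>; on an open set it is the usual \<open>C\<^sup>2\<close>.\<close>

definition C2_on :: "'a::real_normed_vector set \<Rightarrow> ('a \<Rightarrow> real) \<Rightarrow> bool" where
  "C2_on A f \<longleftrightarrow>
     (\<exists>(f' :: 'a \<Rightarrow> 'a \<Rightarrow>\<^sub>L real) (f'' :: 'a \<Rightarrow> 'a \<Rightarrow>\<^sub>L ('a \<Rightarrow>\<^sub>L real)).
        (\<forall>z\<in>A. (f has_derivative blinfun_apply (f' z)) (at z within A)) \<and>
        (\<forall>z\<in>A. (f' has_derivative blinfun_apply (f'' z)) (at z within A)) \<and>
        continuous_on A f'')"

definition space_grad :: "((real ^ 'n) \<times> real \<Rightarrow> real) \<Rightarrow> (real ^ 'n) \<times> real \<Rightarrow> real ^ 'n" where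
  "space_grad f z = (\<chi> i. deriv (\<lambda>h. f (fst z + h *\<^sub>R axis i 1, snd z)) 0)"

definition space_hess :: "((real ^ 'n) \<times> real \<Rightarrow> real) \<Rightarrow> (real ^ 'n) \<times> real \<Rightarrow> real ^ 'n ^ 'n" where
  "space_hess f z =
     (\<chi> i j. deriv (\<lambda>h. space_grad f (fst z + h *\<^sub>R axis j 1, snd z) $ i) 0)"

text \<open>The \<open>t\<close>-derivative is taken from the left, because at points of \<open>\<Sigma>\<close> only times \<open>\<tau> \<le> t\<close> are
  available; it equals the two-sided derivative wherever the latter exists.\<close>

definition time_deriv :: "((real ^ 'n) \<times> real \<Rightarrow> real) \<Rightarrow> (real ^ 'n) \<times> real \<Rightarrow> real" where
  "time_deriv f z = vector_derivative (\<lambda>\<tau>. f (fst z, \<tau>)) (at (snd z) within {..snd z})"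

definition symmetric_matrices :: "(real ^ 'n ^ 'n) set" where
  "symmetric_matrices = {M. transpose M = M}"

definition positive_definite :: "real ^ 'n ^ 'n \<Rightarrow> bool" where
  "positive_definite A \<longleftrightarrow> A \<in> symmetric_matrices \<and> (\<forall>\<xi>. \<xi> \<noteq> 0 \<longrightarrow> 0 < \<xi> \<bullet> (A *v \<xi>))"

text \<open>A nonlinearity \<open>F z s p M\<close>, with \<open>z = (x, t)\<close>, is only meaningful for symmetric \<open>M\<close>.
  \<open>\<partial>F/\<partial>M\<^sub>i\<^sub>j\<close> is therefore the derivative in the direction \<open>(E\<^sub>i\<^sub>j + E\<^sub>j\<^sub>i)/2\<close>; with this normalisation
  the differential of \<open>F\<close> in \<open>M\<close> is \<open>N \<mapsto> \<Sum>\<^sub>i\<^sub>j (\<partial>F/\<partial>M\<^sub>i\<^sub>j) N\<^sub>i\<^sub>j\<close> for symmetric \<open>N\<close>.\<close>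

type_synonym 'n operator =
  "(real ^ 'n) \<times> real \<Rightarrow> real \<Rightarrow> real ^ 'n \<Rightarrow> real ^ 'n ^ 'n \<Rightarrow> real"

definition sym_unit :: "'n \<Rightarrow> 'n \<Rightarrow> real ^ 'n ^ 'n" where
  "sym_unit i j =
     (\<chi> k l. ((if k = i \<and> l = j then 1 else 0) + (if k = j \<and> l = i then 1 else 0)) / 2)"

definition F_s :: "'n operator \<Rightarrow> 'n operator" where
  "F_s F z s p M = deriv (\<lambda>r. F z r p M) s"

definition F_p ::
  "'n operator \<Rightarrow> (real ^ 'n) \<times> real \<Rightarrow> real \<Rightarrow> real ^ 'n \<Rightarrow> real ^ 'n ^ 'n \<Rightarrow> real ^ 'n" where
  "F_p F z s p M = (\<chi> i. deriv (\<lambda>h. F z s (p + h *\<^sub>R axis i 1) M) 0)"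

definition F_M ::
  "'n operator \<Rightarrow> (real ^ 'n) \<times> real \<Rightarrow> real \<Rightarrow> real ^ 'n \<Rightarrow> real ^ 'n ^ 'n \<Rightarrow> real ^ 'n ^ 'n" where
  "F_M F z s p M = (\<chi> i j. deriv (\<lambda>h. F z s p (M + h *\<^sub>R sym_unit i j)) 0)"

definition operator_domain ::
  "((real ^ 'n) \<times> real) set \<Rightarrow>
   (((real ^ 'n) \<times> real) \<times> real \<times> (real ^ 'n) \<times> (real ^ 'n ^ 'n)) set" where
  "operator_domain Z = Z \<times> UNIV \<times> UNIV \<times> symmetric_matrices"

definition continuous_operator :: "((real ^ 'n) \<times> real) set \<Rightarrow> 'n operator \<Rightarrow> bool" where
  "continuous_operator Z F \<longleftrightarrow> continuous_on (operator_domain Z) (\<lambda>(z, s, p, M). F z s p M)"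

definition C1_operator :: "((real ^ 'n) \<times> real) set \<Rightarrow> 'n operator \<Rightarrow> bool" where
  "C1_operator Z F \<longleftrightarrow>
     (\<forall>(z, s, p, M) \<in> operator_domain Z.
        (\<lambda>r. F z r p M) differentiable (at s) \<and>
        (\<forall>i. (\<lambda>h. F z s (p + h *\<^sub>R axis i 1) M) differentiable (at 0)) \<and>
        (\<forall>i j. (\<lambda>h. F z s p (M + h *\<^sub>R sym_unit i j)) differentiable (at 0))) \<and>
     continuous_on (operator_domain Z) (\<lambda>(z, s, p, M). F_s F z s p M) \<and>
     continuous_on (operator_domain Z) (\<lambda>(z, s, p, M). F_p F z s p M) \<and>
     continuous_on (operator_domain Z) (\<lambda>(z, s, p, M). F_M F z s p M)"

definition elliptic_operator :: "((real ^ 'n) \<times> real) set \<Rightarrow> 'n operator \<Rightarrow> bool" where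
  "elliptic_operator Z F \<longleftrightarrow>
     (\<forall>(z, s, p, M) \<in> operator_domain Z. positive_definite (F_M F z s p M))"

text \<open>\<open>\<Sigma>\<close> is a relatively open piece of \<open>{t = T}\<close> contained in \<open>\<partial>\<Omega>\<close>, and it is a boundary portion in the
  sense that \<open>\<Omega>\<close> fills the side \<open>{t < T}\<close> near each of its points.  The last conjunct expresses this and
  does not follow from the others: infinitely many slits of \<open>\<Omega>\<close> may accumulate at \<open>\<Sigma>\<close>.\<close>

definition flat_top_portion :: "((real ^ 'n) \<times> real) set \<Rightarrow> real \<Rightarrow> ((real ^ 'n) \<times> real) set \<Rightarrow> bool" where
  "flat_top_portion \<Omega> T S \<longleftrightarrow>
     openin (top_of_set {z. snd z = T}) S \<and>
     S \<subseteq> frontier \<Omega> \<and>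
     openin (top_of_set {z. snd z \<le> T}) (\<Omega> \<union> S)"

text \<open>The inequality \<open>F(x,t,u,\<nabla>u,\<nabla>\<^sup>2u) - u\<^sub>t \<le> F(x,t,v,\<nabla>v,\<nabla>\<^sup>2v) - v\<^sub>t\<close> on \<open>A\<close> in the viscosity sense.\<close>

definition viscosity_ineq_on ::
  "((real ^ 'n) \<times> real) set \<Rightarrow> 'n operator \<Rightarrow>
   ((real ^ 'n) \<times> real \<Rightarrow> real) \<Rightarrow> ((real ^ 'n) \<times> real \<Rightarrow> real) \<Rightarrow> bool" where
  "viscosity_ineq_on A F u v \<longleftrightarrow>
     (\<forall>z\<in>A. \<forall>\<phi> U. open U \<and> z \<in> U \<and> C2_on U \<phi> \<and> (\<forall>w \<in> A \<inter> U. \<phi> w \<le> u w) \<and> \<phi> z = u z \<longrightarrow>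
        F z (\<phi> z) (space_grad \<phi> z) (space_hess \<phi> z) - time_deriv \<phi> z
        \<le> F z (v z) (space_grad v z) (space_hess v z) - time_deriv v z)"

definition C_set ::
  "((real ^ 'n) \<times> real) set \<Rightarrow> ((real ^ 'n) \<times> real) set \<Rightarrow> (real ^ 'n) \<times> real \<Rightarrow> ((real ^ 'n) \<times> real) set"
  where
  "C_set \<Omega> S P = path_component_set {z \<in> \<Omega> \<union> S. snd z = snd P} P"

definition S_set ::
  "((real ^ 'n) \<times> real) set \<Rightarrow> ((real ^ 'n) \<times> real) set \<Rightarrow> (real ^ 'n) \<times> real \<Rightarrow> ((real ^ 'n) \<times> real) set"
  where
  "S_set \<Omega> S P =
     {Q \<in> \<Omega>. \<exists>g. path g \<and> path_image g \<subseteq> \<Omega> \<union> S \<and> pathstart g = Q \<and> pathfinish g = P \<and>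
                 mono_on {0..1} (\<lambda>\<theta>. snd (g \<theta>))}"

end

theory Submission
  imports Defs
begin

text \<open>
  Write \<open>A = \<Omega> \<union> \<Sigma>\<close> and \<open>w = u - v \<ge> 0\<close>.  Everything follows from one local fact: if \<open>w\<close> vanishes at
  \<open>z\<^sub>0 \<in> A\<close>, then it vanishes at all points of \<open>A\<close> near \<open>z\<^sub>0\<close> whose time is at most that of \<open>z\<^sub>0\<close>
  (\<open>zero_gap_spreads_backward\<close>).  Given this, the zeros of \<open>w\<close> along a curve ending in \<open>P\<close> on which time
  is nondecreasing form a set that is closed, because \<open>w\<close> is lower semicontinuous, and that extends
  to the left of each of its points; so \<open>w\<close> vanishes on the whole curve (\<open>zero_gap_along_path\<close>).  Curves
  inside a time slice give \<open>C\<^sub>P\<close>, the others give \<open>S\<^sub>P\<close>.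

  The local fact is, in contrapositive form, that positivity of \<open>w\<close> at \<open>z\<^sub>1 = (x\<^sub>1, t\<^sub>1)\<close> spreads to every
  nearby later point \<open>z\<^sub>0 = (x\<^sub>0, t\<^sub>0)\<close>.  Take a thin cylinder whose axis is the segment from \<open>z\<^sub>1\<close> to \<open>z\<^sub>0\<close>,
  prolonged a little beyond \<open>z\<^sub>0\<close>, such that \<open>w\<close> is bounded below by a positive constant on its bottom.  With
  \<open>y\<close> the distance vector from the axis and \<open>q = R\<^sup>2 - |y|\<^sup>2\<close>, the bump \<open>\<epsilon> exp (- \<gamma> (t - t\<^sub>1)) q\<^sup>2\<close> is a strict
  subsolution of the linearised equation in the cylinder as soon as \<open>\<gamma>\<close> is large: the rank one part
  \<open>8 y \<otimes> y\<close> of its Hessian wins where \<open>q\<close> is small, and the decay in time wins where it is not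
  (\<open>bump_decay_rate_exists\<close>).  Hence \<open>w\<close> minus the bump has no negative interior minimum
  (\<open>gap_exceeds_touching_bump\<close>), and \<open>w > 0\<close> at \<open>z\<^sub>0\<close>.  The bump travels obliquely, so all earlier points
  are reached at once; points at the same time as \<open>z\<^sub>0\<close> follow by lower semicontinuity, since
  positivity of \<open>w\<close> at such a point would persist slightly before it.

  Two devices make this work for the nonlinear operator and up to \<open>\<Sigma>\<close>.  First, \<open>v\<close> plus the bump is only
  \<open>C\<^sup>2\<close> up to \<open>\<Sigma>\<close> and not across it.  Its second-order Taylor polynomial at the contact point minus \<open>\<delta>\<close>
  times the squared distance is an admissible test function, and \<open>\<delta> \<rightarrow> 0\<close> yields the viscosity
  inequality for \<open>v\<close> plus the bump itself (\<open>one_sided_test_function\<close>).  Secondly, no global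
  ellipticity is available, but the jets of \<open>v\<close> over a compact set are compact, so uniform constants for the
  linearised operator exist there, and a bump of small amplitude only explores a small neighbourhood of these
  jets (\<open>linearised_lower_bound\<close>).
\<close>

section \<open>Functions of class \<open>C\<^sup>2\<close> on an arbitrary set\<close>

lemma C2_onI:
  fixes f' :: "'a::real_normed_vector \<Rightarrow> 'a \<Rightarrow>\<^sub>L real" and f'' :: "'a \<Rightarrow> 'a \<Rightarrow>\<^sub>L ('a \<Rightarrow>\<^sub>L real)"
  assumes "\<And>z. z \<in> A \<Longrightarrow> (f has_derivative blinfun_apply (f' z)) (at z within A)"
    and "\<And>z. z \<in> A \<Longrightarrow> (f' has_derivative blinfun_apply (f'' z)) (at z within A)"
    and "continuous_on A f''"
  shows "C2_on A f"
  using assms unfolding C2_on_def by blast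

lemma C2_onE:
  fixes A :: "'a::real_normed_vector set"
  assumes "C2_on A f"
  obtains f' :: "'a \<Rightarrow> 'a \<Rightarrow>\<^sub>L real" and f'' :: "'a \<Rightarrow> 'a \<Rightarrow>\<^sub>L ('a \<Rightarrow>\<^sub>L real)"
  where "\<And>z. z \<in> A \<Longrightarrow> (f has_derivative blinfun_apply (f' z)) (at z within A)"
    and "\<And>z. z \<in> A \<Longrightarrow> (f' has_derivative blinfun_apply (f'' z)) (at z within A)"
    and "continuous_on A f''"
    and "continuous_on A f" and "continuous_on A f'"
  using assms unfolding C2_on_def
  by (metis has_derivative_continuous continuous_on_eq_continuous_within)

lemma C2_on_linear:
  fixes L :: "'a::real_normed_vector \<Rightarrow> real"
  assumes "bounded_linear L"
  shows "C2_on A L"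
proof (rule C2_onI)
  show "(L has_derivative blinfun_apply (Blinfun L)) (at z within A)" for z
    using assms by (simp add: bounded_linear_Blinfun_apply bounded_linear_imp_has_derivative)
  show "((\<lambda>_. Blinfun L) has_derivative blinfun_apply 0) (at z within A)" for z
    by (simp add: zero_blinfun.rep_eq)
  show "continuous_on A (\<lambda>_. 0 :: 'a \<Rightarrow>\<^sub>L ('a \<Rightarrow>\<^sub>L real))"
    by simp
qed

lemma C2_on_const: "C2_on A (\<lambda>_. c)"
proof (rule C2_onI)
  show "((\<lambda>_. c) has_derivative blinfun_apply 0) (at z within A)" for z
    by (simp add: zero_blinfun.rep_eq)
  show "((\<lambda>_. 0) has_derivative blinfun_apply 0) (at z within A)" for z
    by (simp add: zero_blinfun.rep_eq)
  show "continuous_on A (\<lambda>_. 0 :: 'a \<Rightarrow>\<^sub>L ('a \<Rightarrow>\<^sub>L real))"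
    by simp
qed

lemma C2_on_add:
  fixes f g :: "'a::real_normed_vector \<Rightarrow> real"
  assumes "C2_on A f" and "C2_on A g"
  shows "C2_on A (\<lambda>z. f z + g z)"
proof -
  obtain f' f'' where f: "\<And>z. z \<in> A \<Longrightarrow> (f has_derivative blinfun_apply (f' z)) (at z within A)"
    "\<And>z. z \<in> A \<Longrightarrow> (f' has_derivative blinfun_apply (f'' z)) (at z within A)" "continuous_on A f''"
    using C2_onE[OF assms(1)] by metis
  obtain g' g'' where g: "\<And>z. z \<in> A \<Longrightarrow> (g has_derivative blinfun_apply (g' z)) (at z within A)"
    "\<And>z. z \<in> A \<Longrightarrow> (g' has_derivative blinfun_apply (g'' z)) (at z within A)" "continuous_on A g''"
    using C2_onE[OF assms(2)] by metis
  show ?thesis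
  proof (rule C2_onI)
    show "((\<lambda>z. f z + g z) has_derivative blinfun_apply (f' z + g' z)) (at z within A)" if "z \<in> A" for z
      using f(1)[OF that] g(1)[OF that]
      by (auto intro!: derivative_eq_intros simp: fun_eq_iff blinfun.add_left)
    show "((\<lambda>z. f' z + g' z) has_derivative blinfun_apply (f'' z + g'' z)) (at z within A)" if "z \<in> A" for z
      using f(2)[OF that] g(2)[OF that]
      by (auto intro!: derivative_eq_intros simp: fun_eq_iff blinfun.add_left)
    show "continuous_on A (\<lambda>z. f'' z + g'' z)"
      using f(3) g(3) by (intro continuous_intros)
  qed
qed

lemma C2_on_mult:
  fixes f g :: "'a::real_normed_vector \<Rightarrow> real"
  assumes "C2_on A f" and "C2_on A g"
  shows "C2_on A (\<lambda>z. f z * g z)"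
proof -
  obtain f' f'' where f: "\<And>z. z \<in> A \<Longrightarrow> (f has_derivative blinfun_apply (f' z)) (at z within A)"
    "\<And>z. z \<in> A \<Longrightarrow> (f' has_derivative blinfun_apply (f'' z)) (at z within A)"
    "continuous_on A f''" "continuous_on A f" "continuous_on A f'"
    using C2_onE[OF assms(1)] by metis
  obtain g' g'' where g: "\<And>z. z \<in> A \<Longrightarrow> (g has_derivative blinfun_apply (g' z)) (at z within A)"
    "\<And>z. z \<in> A \<Longrightarrow> (g' has_derivative blinfun_apply (g'' z)) (at z within A)"
    "continuous_on A g''" "continuous_on A g" "continuous_on A g'"
    using C2_onE[OF assms(2)] by metis
  show ?thesis
  proof (rule C2_onI)
    show "((\<lambda>z. f z * g z) has_derivative blinfun_apply (g z *\<^sub>R f' z + f z *\<^sub>R g' z)) (at z within A)"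
      if "z \<in> A" for z
      using f(1)[OF that] g(1)[OF that]
      by (auto intro!: derivative_eq_intros simp: fun_eq_iff blinfun.add_left blinfun.scaleR_left)
    show "((\<lambda>z. g z *\<^sub>R f' z + f z *\<^sub>R g' z) has_derivative blinfun_apply
        (g z *\<^sub>R f'' z + (blinfun_scaleR_left (f' z) o\<^sub>L g' z)
          + (f z *\<^sub>R g'' z + (blinfun_scaleR_left (g' z) o\<^sub>L f' z)))) (at z within A)"
      if "z \<in> A" for z
      using f(1,2)[OF that] g(1,2)[OF that]
      by (auto intro!: derivative_eq_intros simp: fun_eq_iff blinfun.add_left blinfun.scaleR_left)
    show "continuous_on A (\<lambda>z. g z *\<^sub>R f'' z + (blinfun_scaleR_left (f' z) o\<^sub>L g' z)
          + (f z *\<^sub>R g'' z + (blinfun_scaleR_left (g' z) o\<^sub>L f' z)))"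
      using f(3-5) g(3-5)
      by (intro continuous_intros bounded_linear.continuous_on[OF bounded_linear_blinfun_scaleR_left])
  qed
qed

lemma C2_on_exp:
  fixes f :: "'a::real_normed_vector \<Rightarrow> real"
  assumes "C2_on A f"
  shows "C2_on A (\<lambda>z. exp (f z))"
proof -
  obtain f' f'' where f: "\<And>z. z \<in> A \<Longrightarrow> (f has_derivative blinfun_apply (f' z)) (at z within A)"
    "\<And>z. z \<in> A \<Longrightarrow> (f' has_derivative blinfun_apply (f'' z)) (at z within A)"
    "continuous_on A f''" "continuous_on A f" "continuous_on A f'"
    using C2_onE[OF assms(1)] by metis
  show ?thesis
  proof (rule C2_onI)
    show "((\<lambda>z. exp (f z)) has_derivative blinfun_apply (exp (f z) *\<^sub>R f' z)) (at z within A)"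
      if "z \<in> A" for z
      using f(1)[OF that]
      by (auto intro!: derivative_eq_intros simp: fun_eq_iff blinfun.scaleR_left)
    show "((\<lambda>z. exp (f z) *\<^sub>R f' z) has_derivative blinfun_apply
        (exp (f z) *\<^sub>R f'' z + (blinfun_scaleR_left (exp (f z) *\<^sub>R f' z) o\<^sub>L f' z))) (at z within A)"
      if "z \<in> A" for z
      using f(1,2)[OF that]
      by (auto intro!: derivative_eq_intros simp: fun_eq_iff blinfun.add_left blinfun.scaleR_left)
    show "continuous_on A (\<lambda>z. exp (f z) *\<^sub>R f'' z
        + (blinfun_scaleR_left (exp (f z) *\<^sub>R f' z) o\<^sub>L f' z))"
      using f(3-5)
      by (intro continuous_intros bounded_linear.continuous_on[OF bounded_linear_blinfun_scaleR_left])
  qed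
qed

lemma C2_on_sum:
  fixes f :: "'i \<Rightarrow> 'a::real_normed_vector \<Rightarrow> real"
  assumes "\<And>i. i \<in> I \<Longrightarrow> C2_on A (f i)"
  shows "C2_on A (\<lambda>z. \<Sum>i\<in>I. f i z)"
  using assms
  by (induction I rule: infinite_finite_induct) (auto intro: C2_on_const C2_on_add)

lemma C2_on_diff:
  fixes f g :: "'a::real_normed_vector \<Rightarrow> real"
  assumes "C2_on A f" and "C2_on A g"
  shows "C2_on A (\<lambda>z. f z - g z)"
  using C2_on_add[OF assms(1) C2_on_mult[OF C2_on_const[of _ "-1"] assms(2)]] by simp

lemma C2_on_power2:
  fixes f :: "'a::real_normed_vector \<Rightarrow> real"
  shows "C2_on A f \<Longrightarrow> C2_on A (\<lambda>z. (f z)\<^sup>2)"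
  by (simp add: power2_eq_square C2_on_mult)

lemma C2_on_inner_affine:
  fixes L :: "'a::euclidean_space \<Rightarrow> 'b::euclidean_space"
  assumes "bounded_linear L"
  shows "C2_on A (\<lambda>z. (L z + c) \<bullet> (L z + c))"
proof -
  have "C2_on A (\<lambda>z. (\<Sum>b\<in>Basis. (L z \<bullet> b + c \<bullet> b) * (L z \<bullet> b + c \<bullet> b)))"
    by (intro C2_on_sum C2_on_mult C2_on_add C2_on_const C2_on_linear
        bounded_linear_compose[OF bounded_linear_inner_left assms])
  then show ?thesis
    by (subst euclidean_inner) (simp add: inner_add_left)
qed

text \<open>Expanding one argument in the standard basis turns the form into a sum of products of affine functions.\<close>

lemma C2_on_quadratic_form:
  fixes \<beta> :: "'a::euclidean_space \<Rightarrow>\<^sub>L ('a \<Rightarrow>\<^sub>L real)"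
  shows "C2_on A (\<lambda>w. \<beta> (w - z) (w - z))"
proof -
  have 1: "\<beta> d d = (\<Sum>b\<in>Basis. (d \<bullet> b) * \<beta> b d)" for d
  proof -
    have "\<beta> d d = \<beta> (\<Sum>b\<in>Basis. (d \<bullet> b) *\<^sub>R b) d" by (simp add: euclidean_representation)
    also have "\<dots> = (\<Sum>b\<in>Basis. (d \<bullet> b) * \<beta> b d)"
      by (simp add: blinfun.sum_right blinfun.scaleR_right blinfun.sum_left blinfun.scaleR_left)
    finally show ?thesis .
  qed
  have "C2_on A (\<lambda>w. (\<Sum>b\<in>Basis. (w \<bullet> b - z \<bullet> b) * (\<beta> b w - \<beta> b z)))"
    by (intro C2_on_sum C2_on_mult C2_on_diff C2_on_const C2_on_linear bounded_linear_inner_left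
        blinfun.bounded_linear_right)
  then show ?thesis
    by (subst 1) (simp add: inner_diff_left blinfun.diff_right)
qed

section \<open>Derivatives in relatively open subsets of a half-space\<close>

type_synonym 'n spacetime = "(real ^ 'n) \<times> real"

lemma rel_open_half_ball:
  fixes A :: "('n::finite) spacetime set"
  assumes "openin (top_of_set {z. snd z \<le> T}) A" and "z \<in> A"
  obtains r where "r > 0" "cball z r \<inter> {w. snd w \<le> T} \<subseteq> A"
  using assms unfolding openin_contains_cball by blast

lemma rel_open_top:
  fixes A :: "('n::finite) spacetime set"
  assumes "openin (top_of_set {z. snd z \<le> T}) A" and "z \<in> A"
  shows "snd z \<le> T"
  using assms openin_imp_subset by fastforce

lemma eventually_space_shift_in:
  fixes A :: "('n::finite) spacetime set"
  assumes A: "openin (top_of_set {z. snd z \<le> T}) A" "z \<in> A" and e: "snd e = 0"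
  shows "\<forall>\<^sub>F h in nhds 0. z + h *\<^sub>R e \<in> A"
proof -
  obtain r where r: "r > 0" "cball z r \<inter> {w. snd w \<le> T} \<subseteq> A"
    using rel_open_half_ball[OF A] .
  have "((\<lambda>h::real. z + h *\<^sub>R e) \<longlongrightarrow> z) (at 0)"
    by (auto intro!: tendsto_eq_intros)
  then have "\<forall>\<^sub>F h in at 0. dist (z + h *\<^sub>R e) z < r"
    using r(1) tendstoD by blast
  then have "\<forall>\<^sub>F h in nhds 0. dist (z + h *\<^sub>R e) z < r"
    unfolding eventually_nhds_conv_at using r(1) by simp
  then show ?thesis
    by eventually_elim (use r(2) e rel_open_top[OF A] in \<open>auto simp: dist_commute\<close>)
qed

text \<open>A spatial line through a point of \<open>A\<close> stays in its time slice, hence in \<open>A\<close> for a while in both directions.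
  Spatial derivatives are therefore two-sided even at the final time.\<close>

lemma has_vector_derivative_space_line:
  fixes A :: "('n::finite) spacetime set" and f :: "'n spacetime \<Rightarrow> 'b::real_normed_vector"
  assumes A: "openin (top_of_set {z. snd z \<le> T}) A" "z \<in> A" and e: "snd e = 0"
    and f: "(f has_derivative f') (at z within A)"
  shows "((\<lambda>h. f (z + h *\<^sub>R e)) has_vector_derivative f' e) (at 0)"
proof -
  obtain B where B: "open B" "(0::real) \<in> B" "\<And>h. h \<in> B \<Longrightarrow> z + h *\<^sub>R e \<in> A"
    using eventually_space_shift_in[OF A e] unfolding eventually_nhds by blast
  have "((\<lambda>h. z + h *\<^sub>R e) has_derivative (\<lambda>h. h *\<^sub>R e)) (at 0 within B)"
    by (auto intro!: derivative_eq_intros)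
  moreover have "(f has_derivative f') (at (z + 0 *\<^sub>R e) within (\<lambda>h. z + h *\<^sub>R e) ` B)"
    using has_derivative_subset[OF f image_subsetI[OF B(3)]] by simp
  ultimately have "((\<lambda>h. f (z + h *\<^sub>R e)) has_derivative (\<lambda>h. f' (h *\<^sub>R e))) (at 0 within B)"
    by (rule has_derivative_in_compose)
  then have "((\<lambda>h. f (z + h *\<^sub>R e)) has_derivative (\<lambda>h. f' (h *\<^sub>R e))) (at 0)"
    unfolding at_within_open[OF B(2,1)] .
  moreover have "f' (h *\<^sub>R e) = h *\<^sub>R f' e" for h
    by (rule linear_scale[OF has_derivative_linear[OF f]])
  ultimately show ?thesis
    unfolding has_vector_derivative_def by simp
qed

abbreviation space_unit :: "('n::finite) \<Rightarrow> 'n spacetime" where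
  "space_unit i \<equiv> (axis i 1, 0)"

lemma space_shift: "(fst z + h *\<^sub>R axis i 1, snd z) = z + h *\<^sub>R space_unit i"
  by (simp add: prod_eq_iff)

lemma space_grad_eq:
  fixes A :: "('n::finite) spacetime set"
  assumes A: "openin (top_of_set {z. snd z \<le> T}) A" "z \<in> A"
    and f: "(f has_derivative f') (at z within A)"
  shows "space_grad f z = (\<chi> i. f' (space_unit i))"
proof -
  have "((\<lambda>h. f (z + h *\<^sub>R space_unit i)) has_real_derivative f' (space_unit i)) (at 0)" for i
    unfolding has_real_derivative_iff_has_vector_derivative
    by (rule has_vector_derivative_space_line[OF A _ f]) simp
  then show ?thesis
    unfolding space_grad_def space_shift vec_eq_iff by (simp add: DERIV_imp_deriv)
qed

lemma space_hess_eq: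
  fixes A :: "('n::finite) spacetime set" and f' :: "'n spacetime \<Rightarrow> 'n spacetime \<Rightarrow>\<^sub>L real"
  assumes A: "openin (top_of_set {z. snd z \<le> T}) A" "z \<in> A"
    and f: "\<And>w. w \<in> A \<Longrightarrow> (f has_derivative f' w) (at w within A)"
    and f': "(f' has_derivative f'') (at z within A)"
  shows "space_hess f z = (\<chi> i j. f'' (space_unit j) (space_unit i))"
proof -
  have "((\<lambda>h. space_grad f (z + h *\<^sub>R space_unit j) $ i) has_real_derivative
          f'' (space_unit j) (space_unit i)) (at 0)" for i j
  proof -
    have "((\<lambda>h. f' (z + h *\<^sub>R space_unit j)) has_vector_derivative f'' (space_unit j)) (at 0)"
      by (intro has_vector_derivative_space_line[OF A]) (use f' in auto)
    then have "((\<lambda>h. f' (z + h *\<^sub>R space_unit j) (space_unit i)) has_vector_derivative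
        f'' (space_unit j) (space_unit i)) (at 0)"
      by (rule bounded_linear.has_vector_derivative[OF bounded_linear_apply_blinfun])
    then have *: "((\<lambda>h. f' (z + h *\<^sub>R space_unit j) (space_unit i)) has_real_derivative
        f'' (space_unit j) (space_unit i)) (at 0)"
      by (simp add: has_real_derivative_iff_has_vector_derivative)
    have "\<forall>\<^sub>F h in nhds 0. z + h *\<^sub>R space_unit j \<in> A"
      by (rule eventually_space_shift_in[OF A]) simp
    then have "\<forall>\<^sub>F h in nhds 0. f' (z + h *\<^sub>R space_unit j) (space_unit i)
        = space_grad f (z + h *\<^sub>R space_unit j) $ i"
      by eventually_elim (simp add: space_grad_eq[OF A(1) _ f])
    then show ?thesis
      using * by (subst (asm) DERIV_cong_ev) auto
  qed
  then show ?thesis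
    unfolding space_hess_def space_shift vec_eq_iff by (simp add: DERIV_imp_deriv)
qed

lemma time_deriv_eqI:
  assumes "((\<lambda>\<tau>. f (fst z, \<tau>)) has_real_derivative D) (at (snd z) within {..snd z})"
  shows "time_deriv f z = D"
proof -
  have "at (snd z) within {..snd z} \<noteq> bot"
  proof
    assume "at (snd z) within {..snd z} = bot"
    moreover have "at (snd z) within {..<snd z} \<le> at (snd z) within {..snd z}"
      by (rule at_le) auto
    ultimately show False
      by (metis bot.extremum_uniqueI trivial_limit_at_left_real)
  qed
  then show ?thesis
    using assms unfolding time_deriv_def has_real_derivative_iff_has_vector_derivative
    by (rule vector_derivative_within)
qed

lemma time_deriv_eq:
  fixes A :: "('n::finite) spacetime set"
  assumes A: "openin (top_of_set {z. snd z \<le> T}) A" "z \<in> A"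
    and f: "(f has_derivative f') (at z within A)"
  shows "time_deriv f z = f' (0, 1)"
proof -
  obtain r where r: "r > 0" "cball z r \<inter> {w. snd w \<le> T} \<subseteq> A"
    using rel_open_half_ball[OF A] .
  define B where "B = {snd z - r..snd z}"
  have BA: "(fst z, \<tau>) \<in> A" if "\<tau> \<in> B" for \<tau>
  proof -
    have "dist z (fst z, \<tau>) \<le> r"
      using that by (auto simp: B_def dist_prod_def dist_real_def)
    moreover have "\<tau> \<le> T"
      using that rel_open_top[OF A] by (auto simp: B_def)
    ultimately show ?thesis using r(2) by auto
  qed
  have "((\<lambda>\<tau>. (fst z, \<tau>)) has_derivative (\<lambda>h. (0, h))) (at (snd z) within B)"
    by (auto intro!: derivative_eq_intros)
  moreover have "(f has_derivative f') (at (fst z, snd z) within (\<lambda>\<tau>. (fst z, \<tau>)) ` B)"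
    using has_derivative_subset[OF f image_subsetI[OF BA]] by simp
  ultimately have *: "((\<lambda>\<tau>. f (fst z, \<tau>)) has_derivative (\<lambda>h. f' (0, h))) (at (snd z) within B)"
    by (rule has_derivative_in_compose)
  have "f' (0, h) = h *\<^sub>R f' (0, 1)" for h
    using linear_scale[OF has_derivative_linear[OF f], of h "(0,1)"] by simp
  then have "(\<lambda>h. h *\<^sub>R f' (0, 1)) = (\<lambda>h. f' (0, h))"
    by (intro ext) (rule sym)
  then have "((\<lambda>\<tau>. f (fst z, \<tau>)) has_vector_derivative f' (0, 1)) (at (snd z) within B)"
    unfolding has_vector_derivative_def using * by simp
  moreover have "at (snd z) within B = at (snd z) within {..snd z}"
    by (rule at_within_nhd[of _ "{snd z - r<..}"]) (use r(1) in \<open>auto simp: B_def\<close>)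
  ultimately show ?thesis
    by (intro time_deriv_eqI) (simp add: has_real_derivative_iff_has_vector_derivative)
qed

lemma convex_half_ball: "convex (cball z r \<inter> {w::('n::finite) spacetime. snd w \<le> T})"
proof -
  have "{w::('n::finite) spacetime. snd w \<le> T} = {w. (0, 1) \<bullet> w \<le> T}"
    by (auto simp: inner_prod_def)
  then show ?thesis
    by (auto intro: convex_Int convex_halfspace_le)
qed

text \<open>The mixed second difference of \<open>f\<close> is the increment over \<open>a \<in> [0, h]\<close> of
  \<open>f (z + h k + a e) - f (z + a e)\<close>, whose derivative in \<open>a\<close> is \<open>h f'' k e\<close> up to \<open>o(h)\<close> by differentiability of
  \<open>f'\<close> at \<open>z\<close>.  The left-hand side being symmetric in \<open>e\<close> and \<open>k\<close>, so is \<open>f''\<close> on spatial directions.\<close>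

lemma second_difference:
  fixes A :: "('n::finite) spacetime set" and f' :: "'n spacetime \<Rightarrow> 'n spacetime \<Rightarrow>\<^sub>L real"
    and f'' :: "'n spacetime \<Rightarrow>\<^sub>L ('n spacetime \<Rightarrow>\<^sub>L real)"
  assumes A: "openin (top_of_set {z. snd z \<le> T}) A" "z \<in> A"
    and f: "\<And>w. w \<in> A \<Longrightarrow> (f has_derivative f' w) (at w within A)"
    and f': "(f' has_derivative f'') (at z within A)"
    and e: "snd e = 0" "norm e = 1" and k: "snd k = 0" "norm k = 1" and "\<delta> > 0"
  shows "\<exists>s>0. \<forall>h. 0 < h \<and> h < s \<longrightarrow>
    \<bar>f (z + h *\<^sub>R e + h *\<^sub>R k) - f (z + h *\<^sub>R e) - f (z + h *\<^sub>R k) + f z - h\<^sup>2 * f'' k e\<bar> \<le> \<delta> * h\<^sup>2"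
proof -
  obtain r where r: "r > 0" "cball z r \<inter> {w. snd w \<le> T} \<subseteq> A"
    using rel_open_half_ball[OF A] .
  obtain d where d: "d > 0" "\<And>w. w \<in> A \<Longrightarrow> norm (w - z) < d \<Longrightarrow>
      norm (f' w - f' z - f'' (w - z)) \<le> \<delta> / 3 * norm (w - z)"
    using conjunct2[OF f'[unfolded has_derivative_within_alt], rule_format, of "\<delta> / 3"] \<open>\<delta> > 0\<close> by auto
  define s where "s = min r d / 2"
  have "s > 0" using r d by (simp add: s_def)
  moreover have "\<bar>f (z + h *\<^sub>R e + h *\<^sub>R k) - f (z + h *\<^sub>R e) - f (z + h *\<^sub>R k) + f z - h\<^sup>2 * f'' k e\<bar>
      \<le> \<delta> * h\<^sup>2" if h: "0 < h" "h < s" for h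
  proof -
    have nrm: "norm (a *\<^sub>R e + b *\<^sub>R k) \<le> a + b" if "0 \<le> a" "0 \<le> b" for a b
      using norm_triangle_ineq[of "a *\<^sub>R e" "b *\<^sub>R k"] that e k by simp
    have inA: "z + a *\<^sub>R e + b *\<^sub>R k \<in> A" if "0 \<le> a" "a \<le> h" "0 \<le> b" "b \<le> h" for a b
    proof -
      have "dist (z + a *\<^sub>R e + b *\<^sub>R k) z = norm (a *\<^sub>R e + b *\<^sub>R k)"
        unfolding dist_norm by (rule arg_cong[where f = norm]) simp
      then have "dist z (z + a *\<^sub>R e + b *\<^sub>R k) \<le> r"
        unfolding dist_commute[of z] using nrm[of a b] that h by (simp add: s_def)
      then show ?thesis
        using r(2) e(1) k(1) rel_open_top[OF A] by auto
    qed
    have bd: "\<bar>f' (z + a *\<^sub>R e + b *\<^sub>R k) e - f' z e - (a * f'' e e + b * f'' k e)\<bar> \<le> \<delta> / 3 * (a + b)"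
      if "0 \<le> a" "a \<le> h" "0 \<le> b" "b \<le> h" for a b
    proof -
      let ?w = "z + a *\<^sub>R e + b *\<^sub>R k"
      have w: "?w - z = a *\<^sub>R e + b *\<^sub>R k" by simp
      have "norm (f' ?w - f' z - f'' (?w - z)) \<le> \<delta> / 3 * norm (?w - z)"
        using nrm[of a b] that h inA[OF that] by (intro d) (auto simp: w s_def)
      also have "\<dots> \<le> \<delta> / 3 * (a + b)"
        using nrm[of a b] that \<open>\<delta> > 0\<close> unfolding w by (intro mult_left_mono) auto
      finally have "norm ((f' ?w - f' z - f'' (?w - z)) e) \<le> \<delta> / 3 * (a + b)"
        using norm_blinfun[of "f' ?w - f' z - f'' (?w - z)" e, unfolded e(2) mult_1_right] by linarith
      then show ?thesis
        unfolding w by (simp add: blinfun.diff_left blinfun.add_left blinfun.add_right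
            blinfun.scaleR_left blinfun.scaleR_right)
    qed
    define \<phi> where "\<phi> = (\<lambda>a. f (z + h *\<^sub>R k + a *\<^sub>R e) - f (z + a *\<^sub>R e) - a * (h * f'' k e))"
    have line: "((\<lambda>a. f (z + c *\<^sub>R k + a *\<^sub>R e)) has_real_derivative f' (z + a *\<^sub>R e + c *\<^sub>R k) e)
        (at a within {0..h})" if "0 \<le> a" "a \<le> h" "0 \<le> c" "c \<le> h" for a c
    proof -
      let ?w = "z + a *\<^sub>R e + c *\<^sub>R k"
      have "((\<lambda>b. f (?w + b *\<^sub>R e)) has_real_derivative f' ?w e) (at 0)"
        unfolding has_real_derivative_iff_has_vector_derivative
        by (rule has_vector_derivative_space_line[OF A(1) inA[OF that] e(1) f[OF inA[OF that]]])
      then have "((\<lambda>b. f (?w + (b - a) *\<^sub>R e)) has_real_derivative f' ?w e) (at a)"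
        using DERIV_shift[of "\<lambda>b. f (?w + (b - a) *\<^sub>R e)" "f' ?w e" 0 a] by simp
      then show ?thesis
        by (auto simp: algebra_simps intro: DERIV_subset)
    qed
    have "(\<phi> has_real_derivative f' (z + a *\<^sub>R e + h *\<^sub>R k) e - f' (z + a *\<^sub>R e + 0 *\<^sub>R k) e - h * f'' k e)
        (at a within {0..h})" if "a \<in> {0..h}" for a
      unfolding \<phi>_def using line[of a h] line[of a 0] that h
      by (auto intro!: derivative_eq_intros)
    moreover have "norm (f' (z + a *\<^sub>R e + h *\<^sub>R k) e - f' (z + a *\<^sub>R e + 0 *\<^sub>R k) e - h * f'' k e) \<le> \<delta> * h"
      if "a \<in> {0..h}" for a
    proof -
      have "\<bar>f' (z + a *\<^sub>R e + h *\<^sub>R k) e - f' (z + a *\<^sub>R e + 0 *\<^sub>R k) e - h * f'' k e\<bar>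
          \<le> \<delta> / 3 * (a + h) + \<delta> / 3 * (a + 0)"
      proof -
        have "\<bar>f' (z + a *\<^sub>R e + h *\<^sub>R k) e - f' z e - (a * f'' e e + h * f'' k e)\<bar> \<le> \<delta> / 3 * (a + h)"
          using that h by (intro bd) auto
        moreover have "\<bar>f' (z + a *\<^sub>R e + 0 *\<^sub>R k) e - f' z e - (a * f'' e e + 0 * f'' k e)\<bar> \<le> \<delta> / 3 * (a + 0)"
          using that h by (intro bd) auto
        ultimately show ?thesis by linarith
      qed
      also have "\<dots> \<le> \<delta> / 3 * (h + h) + \<delta> / 3 * (h + 0)"
        using that \<open>\<delta> > 0\<close> by (intro add_mono mult_left_mono) auto
      finally show ?thesis by (simp add: algebra_simps)
    qed
    ultimately have "norm (\<phi> h - \<phi> 0) \<le> \<delta> * h * norm (h - 0)"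
      using h by (intro field_differentiable_bound[of "{0..h}"]) auto
    then show ?thesis
      using h by (simp add: \<phi>_def power2_eq_square algebra_simps)
  qed
  ultimately show ?thesis by blast
qed

lemma space_hess_symmetric:
  fixes A :: "('n::finite) spacetime set"
  assumes A: "openin (top_of_set {z. snd z \<le> T}) A" "z \<in> A" and C2: "C2_on A f"
  shows "space_hess f z \<in> symmetric_matrices"
proof -
  obtain f' f'' where f: "\<And>z. z \<in> A \<Longrightarrow> (f has_derivative blinfun_apply (f' z)) (at z within A)"
    "\<And>z. z \<in> A \<Longrightarrow> (f' has_derivative blinfun_apply (f'' z)) (at z within A)"
    using C2_onE[OF C2] by metis
  have "f'' z e k = f'' z k e" if e: "snd e = 0" "norm e = 1" and k: "snd k = 0" "norm k = 1" for e k
  proof -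
    have "\<bar>f'' z e k - f'' z k e\<bar> \<le> 2 * \<delta>" if \<delta>: "\<delta> > 0" for \<delta>
    proof -
      obtain s1 where s1: "s1 > 0" "\<And>h. 0 < h \<and> h < s1 \<Longrightarrow>
          \<bar>f (z + h *\<^sub>R e + h *\<^sub>R k) - f (z + h *\<^sub>R e) - f (z + h *\<^sub>R k) + f z - h\<^sup>2 * f'' z k e\<bar> \<le> \<delta> * h\<^sup>2"
        using second_difference[OF A f(1) f(2)[OF A(2)] e k \<delta>] by blast
      obtain s2 where s2: "s2 > 0" "\<And>h. 0 < h \<and> h < s2 \<Longrightarrow>
          \<bar>f (z + h *\<^sub>R k + h *\<^sub>R e) - f (z + h *\<^sub>R k) - f (z + h *\<^sub>R e) + f z - h\<^sup>2 * f'' z e k\<bar> \<le> \<delta> * h\<^sup>2"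
        using second_difference[OF A f(1) f(2)[OF A(2)] k e \<delta>] by blast
      define h where "h = min s1 s2 / 2"
      have h: "0 < h" "h < s1" "h < s2" using s1(1) s2(1) by (auto simp: h_def)
      have swap: "z + h *\<^sub>R k + h *\<^sub>R e = z + h *\<^sub>R e + h *\<^sub>R k" by simp
      have "\<bar>h\<^sup>2 * f'' z e k - h\<^sup>2 * f'' z k e\<bar> \<le> 2 * (\<delta> * h\<^sup>2)"
        using s1(2)[of h] s2(2)[of h, unfolded swap] h by linarith
      then have "h\<^sup>2 * \<bar>f'' z e k - f'' z k e\<bar> \<le> h\<^sup>2 * (2 * \<delta>)"
        by (simp only: right_diff_distrib[symmetric] abs_mult) (simp add: mult_ac)
      then show ?thesis using h(1) by simp
    qed
    note bound = this
    have "\<bar>f'' z e k - f'' z k e\<bar> \<le> 0"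
    proof (rule field_le_epsilon)
      fix \<epsilon> :: real assume "\<epsilon> > 0"
      then show "\<bar>f'' z e k - f'' z k e\<bar> \<le> 0 + \<epsilon>"
        using bound[of "\<epsilon> / 2"] by simp
    qed
    then show ?thesis by simp
  qed
  note swap = this
  have "f'' z (space_unit i) (space_unit j) = f'' z (space_unit j) (space_unit i)" for i j
    by (rule swap) (simp_all add: norm_Pair)
  moreover have "space_hess f z = (\<chi> i j. f'' z (space_unit j) (space_unit i))"
    by (rule space_hess_eq[OF A f(1) f(2)[OF A(2)]])
  ultimately show ?thesis
    unfolding symmetric_matrices_def by (simp add: transpose_def vec_eq_iff)
qed

lemma C2_on_continuous_jet:
  fixes A :: "('n::finite) spacetime set"
  assumes A: "openin (top_of_set {z. snd z \<le> T}) A" and C2: "C2_on A f"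
  shows "continuous_on A f" "continuous_on A (space_grad f)" "continuous_on A (space_hess f)"
proof -
  obtain f' f'' where f: "\<And>z. z \<in> A \<Longrightarrow> (f has_derivative blinfun_apply (f' z)) (at z within A)"
    "\<And>z. z \<in> A \<Longrightarrow> (f' has_derivative blinfun_apply (f'' z)) (at z within A)"
    "continuous_on A f''" "continuous_on A f" "continuous_on A f'"
    using C2_onE[OF C2] by metis
  show "continuous_on A f" by (rule f)
  have "continuous_on A (\<lambda>z. f' z e)" for e
    by (rule bounded_linear.continuous_on[OF blinfun.bounded_linear_left f(5)])
  then have "continuous_on A (\<lambda>z. (\<chi> i. f' z (space_unit i)))"
    by (intro continuous_on_vec_lambda)
  then show "continuous_on A (space_grad f)"
  proof (rule continuous_on_eq)
    show "(\<chi> i. f' z (space_unit i)) = space_grad f z" if "z \<in> A" for z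
      by (rule sym, rule space_grad_eq[OF A that f(1)[OF that]])
  qed
  have "continuous_on A (\<lambda>z. f'' z d)" for d
    by (rule bounded_linear.continuous_on[OF blinfun.bounded_linear_left f(3)])
  then have "continuous_on A (\<lambda>z. f'' z d e)" for d e
    by (rule bounded_linear.continuous_on[OF blinfun.bounded_linear_left])
  then have "continuous_on A (\<lambda>z. (\<chi> i j. f'' z (space_unit j) (space_unit i)))"
    by (intro continuous_on_vec_lambda)
  then show "continuous_on A (space_hess f)"
  proof (rule continuous_on_eq)
    show "(\<chi> i j. f'' z (space_unit j) (space_unit i)) = space_hess f z" if "z \<in> A" for z
      by (rule sym, rule space_hess_eq[OF A that f(1) f(2)[OF that]])
  qed
qed

lemma C2_on_add_jet:
  fixes A :: "('n::finite) spacetime set"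
  assumes A: "openin (top_of_set {z. snd z \<le> T}) A" "z \<in> A" and "C2_on A f" "C2_on A g"
  shows "space_grad (\<lambda>w. f w + g w) z = space_grad f z + space_grad g z"
    and "space_hess (\<lambda>w. f w + g w) z = space_hess f z + space_hess g z"
    and "time_deriv (\<lambda>w. f w + g w) z = time_deriv f z + time_deriv g z"
proof -
  obtain f' f'' where f: "\<And>z. z \<in> A \<Longrightarrow> (f has_derivative blinfun_apply (f' z)) (at z within A)"
    "\<And>z. z \<in> A \<Longrightarrow> (f' has_derivative blinfun_apply (f'' z)) (at z within A)"
    using C2_onE[OF assms(3)] by metis
  obtain g' g'' where g: "\<And>z. z \<in> A \<Longrightarrow> (g has_derivative blinfun_apply (g' z)) (at z within A)"
    "\<And>z. z \<in> A \<Longrightarrow> (g' has_derivative blinfun_apply (g'' z)) (at z within A)"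
    using C2_onE[OF assms(4)] by metis
  have s1: "((\<lambda>w. f w + g w) has_derivative blinfun_apply (f' z + g' z)) (at z within A)" if "z \<in> A" for z
    using has_derivative_add[OF f(1)[OF that] g(1)[OF that]]
    by (simp add: plus_blinfun.rep_eq)
  have s2: "((\<lambda>w. f' w + g' w) has_derivative blinfun_apply (f'' z + g'' z)) (at z within A)" if "z \<in> A" for z
    using has_derivative_add[OF f(2)[OF that] g(2)[OF that]]
    by (simp add: plus_blinfun.rep_eq)
  show "space_grad (\<lambda>w. f w + g w) z = space_grad f z + space_grad g z"
    using space_grad_eq[OF A f(1)[OF A(2)]] space_grad_eq[OF A g(1)[OF A(2)]]
      space_grad_eq[OF A s1[OF A(2)]]
    by (simp add: vec_eq_iff blinfun.add_left)
  have "space_hess f z = (\<chi> i j. f'' z (space_unit j) (space_unit i))"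
    "space_hess g z = (\<chi> i j. g'' z (space_unit j) (space_unit i))"
    "space_hess (\<lambda>w. f w + g w) z = (\<chi> i j. (f'' z + g'' z) (space_unit j) (space_unit i))"
    by (rule space_hess_eq[OF A f(1) f(2)[OF A(2)]] space_hess_eq[OF A g(1) g(2)[OF A(2)]]
        space_hess_eq[OF A s1 s2[OF A(2)]]; assumption)+
  then show "space_hess (\<lambda>w. f w + g w) z = space_hess f z + space_hess g z"
    by (simp add: vec_eq_iff blinfun.add_left)
  show "time_deriv (\<lambda>w. f w + g w) z = time_deriv f z + time_deriv g z"
    using time_deriv_eq[OF A f(1)[OF A(2)]] time_deriv_eq[OF A g(1)[OF A(2)]]
      time_deriv_eq[OF A s1[OF A(2)]]
    by (simp add: blinfun.add_left)
qed

text \<open>Along the segment from \<open>z\<close> to \<open>w\<close>, which lies in the convex half-ball, the derivative of the remainder is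
  \<open>f' (z + \<theta> k) k - f' z k - \<theta> f'' k k\<close>, and this is \<open>o(|k|\<^sup>2)\<close> by differentiability of \<open>f'\<close> at \<open>z\<close> alone.\<close>

lemma C2_taylor:
  fixes A :: "('n::finite) spacetime set" and f' :: "'n spacetime \<Rightarrow> 'n spacetime \<Rightarrow>\<^sub>L real"
    and f'' :: "'n spacetime \<Rightarrow>\<^sub>L ('n spacetime \<Rightarrow>\<^sub>L real)"
  assumes A: "openin (top_of_set {z. snd z \<le> T}) A" "z \<in> A"
    and f: "\<And>w. w \<in> A \<Longrightarrow> (f has_derivative f' w) (at w within A)"
    and f': "(f' has_derivative f'') (at z within A)" and "\<delta> > 0"
  obtains r where "r > 0"
    "\<And>w. w \<in> A \<inter> ball z r \<Longrightarrow>
       \<bar>f w - (f z + f' z (w - z) + f'' (w - z) (w - z) / 2)\<bar> \<le> \<delta> * (norm (w - z))\<^sup>2"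
proof -
  obtain r where r: "r > 0" "cball z r \<inter> {w. snd w \<le> T} \<subseteq> A"
    using rel_open_half_ball[OF A] .
  obtain d where d: "d > 0" "\<And>w. w \<in> A \<Longrightarrow> norm (w - z) < d \<Longrightarrow>
      norm (f' w - f' z - f'' (w - z)) \<le> \<delta> * norm (w - z)"
    using conjunct2[OF f'[unfolded has_derivative_within_alt], rule_format, of \<delta>] \<open>\<delta> > 0\<close> by auto
  show ?thesis
  proof (rule that[of "min r d"])
    show "min r d > 0" using r d by simp
  next
    fix w assume w: "w \<in> A \<inter> ball z (min r d)"
    define k where "k = w - z"
    have k: "norm k < r" "norm k < d"
      using w by (auto simp: k_def dist_norm norm_minus_commute)
    have inA: "z + \<theta> *\<^sub>R k \<in> A" if "\<theta> \<in> {0..1}" for \<theta>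
    proof -
      have "z \<in> cball z r \<inter> {w. snd w \<le> T}" "w \<in> cball z r \<inter> {w. snd w \<le> T}"
        using r(1) w rel_open_top[OF A] rel_open_top[OF A(1), of w] by auto
      then have "(1 - \<theta>) *\<^sub>R z + \<theta> *\<^sub>R w \<in> cball z r \<inter> {w. snd w \<le> T}"
        using that by (intro convexD_alt[OF convex_half_ball]) auto
      then show ?thesis using r(2) by (auto simp: k_def algebra_simps)
    qed
    define g where "g = (\<lambda>\<theta>. f (z + \<theta> *\<^sub>R k) - \<theta> * f' z k - \<theta>\<^sup>2 / 2 * f'' k k)"
    have "(g has_real_derivative (f' (z + \<theta> *\<^sub>R k) k - f' z k - \<theta> * f'' k k)) (at \<theta> within {0..1})"
      if "\<theta> \<in> {0..1}" for \<theta>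
    proof -
      have "((\<lambda>\<theta>. z + \<theta> *\<^sub>R k) has_derivative (\<lambda>h. h *\<^sub>R k)) (at \<theta> within {0..1})"
        by (auto intro!: derivative_eq_intros)
      moreover have "(f has_derivative f' (z + \<theta> *\<^sub>R k))
          (at (z + \<theta> *\<^sub>R k) within (\<lambda>\<theta>. z + \<theta> *\<^sub>R k) ` {0..1})"
        by (rule has_derivative_subset[OF f[OF inA[OF that]] image_subsetI[OF inA]])
      ultimately have "((\<lambda>\<theta>. f (z + \<theta> *\<^sub>R k)) has_derivative (\<lambda>h. f' (z + \<theta> *\<^sub>R k) (h *\<^sub>R k)))
          (at \<theta> within {0..1})"
        by (rule has_derivative_in_compose)
      then have "((\<lambda>\<theta>. f (z + \<theta> *\<^sub>R k)) has_real_derivative f' (z + \<theta> *\<^sub>R k) k) (at \<theta> within {0..1})"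
        by (simp add: has_field_derivative_def blinfun.scaleR_right mult_commute_abs)
      then show ?thesis
        unfolding g_def by (auto intro!: derivative_eq_intros)
    qed
    moreover have "norm (f' (z + \<theta> *\<^sub>R k) k - f' z k - \<theta> * f'' k k) \<le> \<delta> * (norm k)\<^sup>2"
      if "\<theta> \<in> {0..1}" for \<theta>
    proof -
      have \<theta>k: "norm (\<theta> *\<^sub>R k) \<le> norm k"
        using that mult_left_le_one_le[of "norm k" \<theta>] by auto
      have "norm (f' (z + \<theta> *\<^sub>R k) - f' z - f'' (\<theta> *\<^sub>R k)) \<le> \<delta> * norm (\<theta> *\<^sub>R k)"
        using d(2)[OF inA[OF that]] \<theta>k k by simp
      also have "\<dots> \<le> \<delta> * norm k"
        using \<theta>k \<open>\<delta> > 0\<close> by (intro mult_left_mono) auto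
      finally have "norm ((f' (z + \<theta> *\<^sub>R k) - f' z - f'' (\<theta> *\<^sub>R k)) k) \<le> \<delta> * norm k * norm k"
        by (meson norm_blinfun mult_right_mono norm_ge_zero order_trans)
      then show ?thesis
        by (simp add: blinfun.diff_left blinfun.scaleR_right blinfun.scaleR_left power2_eq_square)
    qed
    ultimately have "norm (g 1 - g 0) \<le> \<delta> * (norm k)\<^sup>2 * norm (1 - 0 :: real)"
      by (intro field_differentiable_bound[of "{0..1}"]) auto
    then show "\<bar>f w - (f z + f' z (w - z) + f'' (w - z) (w - z) / 2)\<bar> \<le> \<delta> * (norm (w - z))\<^sup>2"
      by (simp add: g_def k_def algebra_simps)
  qed
qed

section \<open>One-sided test functions\<close>

text \<open>Gradient and Hessian of a quadratic test function are computed by restricting it to coordinate lines.\<close>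

lemma polynomial_line_deriv:
  fixes f :: "real \<Rightarrow> real"
  assumes "\<And>h. f h = a + h * b + h\<^sup>2 * c"
  shows "deriv f 0 = b"
proof -
  have "(f has_real_derivative b) (at 0)"
    unfolding assms[abs_def] by (auto intro!: derivative_eq_intros)
  then show ?thesis by (rule DERIV_imp_deriv)
qed

text \<open>A test function \<open>\<Phi>\<close> need only be \<open>C\<^sup>2\<close> on \<open>A\<close> itself, not on a full neighbourhood of the contact point.
  For \<open>\<delta> > 0\<close> the polynomial \<open>\<phi>\<close> obtained from the second-order expansion of \<open>\<Phi>\<close> at \<open>z\<close> by subtracting
  \<open>\<delta> |w - z|\<^sup>2\<close> lies below \<open>\<Phi>\<close> on \<open>A\<close> near \<open>z\<close>; it is smooth everywhere and has the same jet as \<open>\<Phi>\<close> at \<open>z\<close>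
  except that its Hessian is smaller by \<open>2 \<delta>\<close> times the identity.  Continuity of \<open>F\<close> allows \<open>\<delta> \<rightarrow> 0\<close>.\<close>

lemma one_sided_test_function:
  fixes A :: "('n::finite) spacetime set" and F :: "'n operator"
  assumes A: "openin (top_of_set {z. snd z \<le> T}) A" "z \<in> A"
    and contF: "continuous_operator A F" and visc: "viscosity_ineq_on A F u v"
    and C2: "C2_on A \<Phi>" and U: "open U" "z \<in> U" and below: "\<And>w. w \<in> A \<inter> U \<Longrightarrow> \<Phi> w \<le> u w"
    and touch: "\<Phi> z = u z"
  shows "F z (\<Phi> z) (space_grad \<Phi> z) (space_hess \<Phi> z) - time_deriv \<Phi> z
    \<le> F z (v z) (space_grad v z) (space_hess v z) - time_deriv v z"
proof -
  obtain f' f'' where f: "\<And>z. z \<in> A \<Longrightarrow> (\<Phi> has_derivative blinfun_apply (f' z)) (at z within A)"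
    "\<And>z. z \<in> A \<Longrightarrow> (f' has_derivative blinfun_apply (f'' z)) (at z within A)"
    using C2_onE[OF C2] by metis
  define \<alpha> where "\<alpha> = f' z"
  define \<beta> where "\<beta> = f'' z"
  have grad: "space_grad \<Phi> z = (\<chi> i. \<alpha> (space_unit i))"
    unfolding \<alpha>_def by (rule space_grad_eq[OF A f(1)[OF A(2)]])
  have hess: "space_hess \<Phi> z = (\<chi> i j. \<beta> (space_unit j) (space_unit i))"
    unfolding \<beta>_def by (rule space_hess_eq[OF A f(1) f(2)[OF A(2)]])
  have time: "time_deriv \<Phi> z = \<alpha> (0, 1)"
    unfolding \<alpha>_def by (rule time_deriv_eq[OF A f(1)[OF A(2)]])
  have sym: "space_hess \<Phi> z \<in> symmetric_matrices"
    by (rule space_hess_symmetric[OF A C2])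
  have \<beta>_sym: "\<beta> (space_unit i) (space_unit j) = \<beta> (space_unit j) (space_unit i)" for i j
    using sym unfolding hess symmetric_matrices_def by (simp add: transpose_def vec_eq_iff)
  have ineq: "F z (\<Phi> z) (space_grad \<Phi> z) (space_hess \<Phi> z - mat (2 * \<delta>)) - time_deriv \<Phi> z
    \<le> F z (v z) (space_grad v z) (space_hess v z) - time_deriv v z" if \<delta>: "\<delta> > 0" for \<delta>
  proof -
    obtain r where r: "r > 0" "\<And>w. w \<in> A \<inter> ball z r \<Longrightarrow>
       \<bar>\<Phi> w - (\<Phi> z + \<alpha> (w - z) + \<beta> (w - z) (w - z) / 2)\<bar> \<le> \<delta> * (norm (w - z))\<^sup>2"
      using C2_taylor[OF A f(1) f(2)[OF A(2)] \<delta>, folded \<alpha>_def \<beta>_def] by blast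
    define \<Psi> where "\<Psi> = (\<lambda>d. \<alpha> d + \<beta> d d / 2 - \<delta> * (d \<bullet> d))"
    define \<phi> where "\<phi> = (\<lambda>w. \<Phi> z + \<Psi> (w - z))"
    have "C2_on (U \<inter> ball z r) \<phi>"
    proof -
      have "C2_on (U \<inter> ball z r) (\<lambda>w. \<Phi> z + (((\<alpha> w - \<alpha> z) + (1 / 2) * \<beta> (w - z) (w - z))
          - \<delta> * ((w + - z) \<bullet> (w + - z))))"
        by (intro C2_on_add C2_on_diff C2_on_mult C2_on_const C2_on_quadratic_form
            C2_on_inner_affine C2_on_linear blinfun.bounded_linear_right bounded_linear_ident)
      then show ?thesis
        by (simp add: \<phi>_def \<Psi>_def blinfun.diff_right)
    qed
    moreover have "\<phi> w \<le> u w" if "w \<in> A \<inter> (U \<inter> ball z r)" for w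
      using r(2)[of w] below[of w] that unfolding \<phi>_def \<Psi>_def
      by (simp add: abs_le_iff power2_norm_eq_inner)
    moreover have "\<phi> z = \<Phi> z"
      by (simp add: \<phi>_def \<Psi>_def)
    moreover have "space_grad \<phi> w $ i = \<alpha> (space_unit i)
        + (\<beta> (w - z) (space_unit i) + \<beta> (space_unit i) (w - z)) / 2 - 2 * \<delta> * ((w - z) \<bullet> space_unit i)" for w i
    proof -
      define e where "e = space_unit i"
      have "\<phi> (w + h *\<^sub>R e) = \<phi> w + h * (\<alpha> e + (\<beta> (w - z) e + \<beta> e (w - z)) / 2 - 2 * \<delta> * ((w - z) \<bullet> e))
          + h\<^sup>2 * (\<beta> e e / 2 - \<delta> * (e \<bullet> e))" for h
      proof -
        define d where "d = w - z"
        have shift: "w + h *\<^sub>R e - z = d + h *\<^sub>R e" by (simp add: d_def)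
        have "\<phi> (w + h *\<^sub>R e) = \<Phi> z + \<Psi> (d + h *\<^sub>R e)" "\<phi> w = \<Phi> z + \<Psi> d"
          unfolding \<phi>_def shift by (simp_all add: d_def)
        moreover have "\<Psi> (d + h *\<^sub>R e) = \<Psi> d + h * (\<alpha> e + (\<beta> d e + \<beta> e d) / 2 - 2 * \<delta> * (d \<bullet> e))
          + h\<^sup>2 * (\<beta> e e / 2 - \<delta> * (e \<bullet> e))"
          unfolding \<Psi>_def
          by (simp add: blinfun.add_right blinfun.add_left blinfun.scaleR_right blinfun.scaleR_left
              inner_add_left inner_add_right inner_commute[of e d] power2_eq_square)
            (simp add: field_simps)
        ultimately show ?thesis by (simp add: d_def)
      qed
      then show ?thesis
        unfolding space_grad_def space_shift vec_lambda_beta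
        using polynomial_line_deriv[of "\<lambda>h. \<phi> (w + h *\<^sub>R e)"] unfolding e_def by blast
    qed
    note \<phi>_grad = this
    have \<phi>_grad_z: "space_grad \<phi> z = space_grad \<Phi> z"
      unfolding grad vec_eq_iff by (simp add: \<phi>_grad)
    have "space_hess \<phi> z $ i $ j = (space_hess \<Phi> z - mat (2 * \<delta>)) $ i $ j" for i j
    proof -
      have "space_grad \<phi> (z + h *\<^sub>R space_unit j) $ i = \<alpha> (space_unit i)
        + h * ((\<beta> (space_unit j) (space_unit i) + \<beta> (space_unit i) (space_unit j)) / 2
            - 2 * \<delta> * (space_unit j \<bullet> space_unit i)) + h\<^sup>2 * 0" for h
      proof -
        have "z + h *\<^sub>R space_unit j - z = h *\<^sub>R space_unit j" by simp
        then show ?thesis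
          unfolding \<phi>_grad by (simp only: blinfun.scaleR_right blinfun.scaleR_left inner_scaleR_left)
            (simp add: field_simps)
      qed
      then have "space_hess \<phi> z $ i $ j = (\<beta> (space_unit j) (space_unit i) + \<beta> (space_unit i) (space_unit j)) / 2
            - 2 * \<delta> * (space_unit j \<bullet> space_unit i)"
        unfolding space_hess_def space_shift vec_lambda_beta by (rule polynomial_line_deriv)
      then show ?thesis
        by (simp add: hess mat_def \<beta>_sym inner_axis_axis)
    qed
    then have \<phi>_hess: "space_hess \<phi> z = space_hess \<Phi> z - mat (2 * \<delta>)"
      by (simp add: vec_eq_iff)
    have "(\<phi> has_derivative \<alpha>) (at z within A)"
      unfolding \<phi>_def \<Psi>_def
      by (auto intro!: derivative_eq_intros has_derivative_eq_rhs[OF blinfun.FDERIV] simp: fun_eq_iff)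
    then have \<phi>_time: "time_deriv \<phi> z = time_deriv \<Phi> z"
      unfolding time by (rule time_deriv_eq[OF A])
    have "F z (\<phi> z) (space_grad \<phi> z) (space_hess \<phi> z) - time_deriv \<phi> z
      \<le> F z (v z) (space_grad v z) (space_hess v z) - time_deriv v z"
      using visc[unfolded viscosity_ineq_on_def, rule_format, of z "U \<inter> ball z r" \<phi>]
        calculation A(2) U r(1) touch by auto
    then show ?thesis
      unfolding \<phi>_grad_z \<phi>_hess \<phi>_time \<open>\<phi> z = \<Phi> z\<close> .
  qed
  have "continuous_on {0..} (\<lambda>\<delta>. F z (\<Phi> z) (space_grad \<Phi> z) (space_hess \<Phi> z - mat (2 * \<delta>)))"
  proof -
    have "continuous_on {0..} (\<lambda>\<delta>. (\<lambda>(z, s, p, M). F z s p M)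
        (z, \<Phi> z, space_grad \<Phi> z, space_hess \<Phi> z - (2 * \<delta>) *\<^sub>R mat 1))"
    proof (rule continuous_on_compose2[OF contF[unfolded continuous_operator_def]])
      show "continuous_on {0..} (\<lambda>\<delta>. (z, \<Phi> z, space_grad \<Phi> z, space_hess \<Phi> z - (2 * \<delta>) *\<^sub>R mat 1))"
        by (intro continuous_intros)
      show "(\<lambda>\<delta>. (z, \<Phi> z, space_grad \<Phi> z, space_hess \<Phi> z - (2 * \<delta>) *\<^sub>R mat 1)) ` {0..} \<subseteq> operator_domain A"
        using A(2) sym
        by (auto simp: operator_domain_def symmetric_matrices_def transpose_def mat_def vec_eq_iff)
    qed
    moreover have "(2 * \<delta>) *\<^sub>R (mat 1 :: real ^ 'n ^ 'n) = mat (2 * \<delta>)" for \<delta> :: real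
      by (simp add: vec_eq_iff mat_def)
    ultimately show ?thesis by simp
  qed
  then have "((\<lambda>\<delta>. F z (\<Phi> z) (space_grad \<Phi> z) (space_hess \<Phi> z - mat (2 * \<delta>)))
      \<longlongrightarrow> F z (\<Phi> z) (space_grad \<Phi> z) (space_hess \<Phi> z - mat (2 * 0))) (at 0 within {0..})"
    unfolding continuous_on_def by (rule bspec) simp
  then have "((\<lambda>\<delta>. F z (\<Phi> z) (space_grad \<Phi> z) (space_hess \<Phi> z - mat (2 * \<delta>)) - time_deriv \<Phi> z)
      \<longlongrightarrow> F z (\<Phi> z) (space_grad \<Phi> z) (space_hess \<Phi> z - mat (2 * 0)) - time_deriv \<Phi> z) (at_right 0)"
    by (intro tendsto_diff tendsto_const) (rule tendsto_within_subset, auto)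
  moreover have "\<forall>\<^sub>F \<delta> in at_right 0. F z (\<Phi> z) (space_grad \<Phi> z) (space_hess \<Phi> z - mat (2 * \<delta>)) - time_deriv \<Phi> z
     \<le> F z (v z) (space_grad v z) (space_hess v z) - time_deriv v z"
    using ineq by (auto simp: eventually_at_right_field intro!: exI[of _ 1])
  ultimately have "F z (\<Phi> z) (space_grad \<Phi> z) (space_hess \<Phi> z - mat (2 * 0)) - time_deriv \<Phi> z
     \<le> F z (v z) (space_grad v z) (space_hess v z) - time_deriv v z"
    by (intro tendsto_upperbound) auto
  moreover have "mat (2 * 0) = (0 :: real ^ 'n ^ 'n)"
    by (simp add: vec_eq_iff mat_def)
  ultimately show ?thesis by simp
qed

section \<open>Linearisation of the operator\<close>

text \<open>Moving from \<open>y\<close> to \<open>y + \<Sum> c\<^sub>i d\<^sub>i\<close> one direction at a time and using the mean value theorem on each leg compares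
  the increment of \<open>G\<close> with its linearisation when only directional derivatives along the \<open>d\<^sub>i\<close> are known.
  The values \<open>m i\<close> are reference values: the derivatives at \<open>y\<close> give a first-order expansion, \<open>m = 0\<close>
  gives a Lipschitz bound.  The subspace \<open>V\<close> serves the matrix variable, where only symmetric matrices are
  available.\<close>

lemma increment_along_directions:
  fixes G :: "'a::real_normed_vector \<Rightarrow> real" and d :: "'i \<Rightarrow> 'a"
  assumes fin: "finite I" and V: "subspace V" "\<And>i. i \<in> I \<Longrightarrow> d i \<in> V"
    and D: "\<And>x i. x - y \<in> V \<Longrightarrow> norm (x - y) \<le> (\<Sum>i\<in>I. \<bar>c i\<bar> * norm (d i)) \<Longrightarrow> i \<in> I \<Longrightarrow>
      ((\<lambda>h. G (x + h *\<^sub>R d i)) has_real_derivative g x i) (at 0)"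
    and B: "\<And>x i. x - y \<in> V \<Longrightarrow> norm (x - y) \<le> (\<Sum>i\<in>I. \<bar>c i\<bar> * norm (d i)) \<Longrightarrow> i \<in> I \<Longrightarrow>
      \<bar>g x i - m i\<bar> \<le> \<eta>"
  shows "\<bar>G (y + (\<Sum>i\<in>I. c i *\<^sub>R d i)) - G y - (\<Sum>i\<in>I. c i * m i)\<bar> \<le> \<eta> * (\<Sum>i\<in>I. \<bar>c i\<bar>)"
proof -
  have "\<bar>G (y + (\<Sum>i\<in>J. c i *\<^sub>R d i)) - G y - (\<Sum>i\<in>J. c i * m i)\<bar> \<le> \<eta> * (\<Sum>i\<in>J. \<bar>c i\<bar>)"
    if "J \<subseteq> I" for J
    using finite_subset[OF that fin] that
  proof (induction J rule: finite_induct)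
    case empty
    then show ?case by simp
  next
    case (insert k J)
    define x where "x = y + (\<Sum>i\<in>J. c i *\<^sub>R d i)"
    define q where "q = (\<lambda>h. G (x + h *\<^sub>R d k) - h * m k)"
    have near: "x + h *\<^sub>R d k - y \<in> V \<and> norm (x + h *\<^sub>R d k - y) \<le> (\<Sum>i\<in>I. \<bar>c i\<bar> * norm (d i))"
      if h: "\<bar>h\<bar> \<le> \<bar>c k\<bar>" for h
    proof
      have eq: "x + h *\<^sub>R d k - y = (\<Sum>i\<in>J. c i *\<^sub>R d i) + h *\<^sub>R d k"
        by (simp add: x_def)
      show "x + h *\<^sub>R d k - y \<in> V"
        unfolding eq using insert.prems V
        by (intro subspace_add subspace_sum subspace_scale) auto
      have "norm ((\<Sum>i\<in>J. c i *\<^sub>R d i) + h *\<^sub>R d k) \<le> (\<Sum>i\<in>J. \<bar>c i\<bar> * norm (d i)) + \<bar>h\<bar> * norm (d k)"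
        using norm_triangle_ineq[of "\<Sum>i\<in>J. c i *\<^sub>R d i" "h *\<^sub>R d k"] norm_sum[of "\<lambda>i. c i *\<^sub>R d i" J]
        by simp
      also have "\<dots> \<le> (\<Sum>i\<in>insert k J. \<bar>c i\<bar> * norm (d i))"
        using insert.hyps h by (simp add: mult_right_mono)
      also have "\<dots> \<le> (\<Sum>i\<in>I. \<bar>c i\<bar> * norm (d i))"
        using insert.prems fin by (intro sum_mono2) auto
      finally show "norm (x + h *\<^sub>R d k - y) \<le> (\<Sum>i\<in>I. \<bar>c i\<bar> * norm (d i))"
        unfolding eq .
    qed
    have k: "k \<in> I" using insert.prems by simp
    have "(q has_real_derivative g (x + h *\<^sub>R d k) k - m k) (at h within {- \<bar>c k\<bar>..\<bar>c k\<bar>})"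
      if "h \<in> {- \<bar>c k\<bar>..\<bar>c k\<bar>}" for h
    proof -
      have "((\<lambda>t. G (x + h *\<^sub>R d k + t *\<^sub>R d k)) has_real_derivative g (x + h *\<^sub>R d k) k) (at 0)"
        using near[of h] that k by (intro D) (auto simp: abs_le_iff)
      then have "((\<lambda>t. G (x + t *\<^sub>R d k)) has_real_derivative g (x + h *\<^sub>R d k) k) (at h)"
        using DERIV_shift[of "\<lambda>t. G (x + t *\<^sub>R d k)" "g (x + h *\<^sub>R d k) k" 0 h]
        by (simp add: scaleR_left_distrib algebra_simps)
      then have "((\<lambda>t. G (x + t *\<^sub>R d k)) has_real_derivative g (x + h *\<^sub>R d k) k) (at h within {- \<bar>c k\<bar>..\<bar>c k\<bar>})"
        by (rule DERIV_subset) simp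
      then show ?thesis
        unfolding q_def by (auto intro!: derivative_eq_intros)
    qed
    moreover have "norm (g (x + h *\<^sub>R d k) k - m k) \<le> \<eta>" if "h \<in> {- \<bar>c k\<bar>..\<bar>c k\<bar>}" for h
      using B[of "x + h *\<^sub>R d k" k] near[of h] that k by (auto simp: abs_le_iff)
    ultimately have "norm (q (c k) - q 0) \<le> \<eta> * norm (c k - 0)"
      by (intro field_differentiable_bound[of "{- \<bar>c k\<bar>..\<bar>c k\<bar>}"]) auto
    then have step: "\<bar>G (x + c k *\<^sub>R d k) - G x - c k * m k\<bar> \<le> \<eta> * \<bar>c k\<bar>"
      by (simp add: q_def algebra_simps)
    have IH: "\<bar>G x - G y - (\<Sum>i\<in>J. c i * m i)\<bar> \<le> \<eta> * (\<Sum>i\<in>J. \<bar>c i\<bar>)"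
      unfolding x_def using insert by auto
    have end_point: "y + (\<Sum>i\<in>insert k J. c i *\<^sub>R d i) = x + c k *\<^sub>R d k"
      using insert.hyps by (simp add: x_def algebra_simps)
    have "(\<Sum>i\<in>insert k J. c i * m i) = c k * m k + (\<Sum>i\<in>J. c i * m i)"
      "\<eta> * (\<Sum>i\<in>insert k J. \<bar>c i\<bar>) = \<eta> * \<bar>c k\<bar> + \<eta> * (\<Sum>i\<in>J. \<bar>c i\<bar>)"
      using insert.hyps by (simp_all add: distrib_left)
    then show ?case
      unfolding end_point using step IH by linarith
  qed
  then show ?thesis by blast
qed

lemma symmetric_matrices_iff: "M \<in> symmetric_matrices \<longleftrightarrow> (\<forall>i j. M $ i $ j = M $ j $ i)"
  unfolding symmetric_matrices_def transpose_def vec_eq_iff by (simp, metis)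

lemma subspace_symmetric_matrices: "subspace (symmetric_matrices :: (real ^ 'n ^ 'n) set)"
  unfolding subspace_def
proof (intro conjI ballI allI)
  show "0 \<in> (symmetric_matrices :: (real ^ 'n ^ 'n) set)" by (simp add: symmetric_matrices_iff)
  show "x + y \<in> symmetric_matrices" if "x \<in> symmetric_matrices" "y \<in> symmetric_matrices" for x y :: "real ^ 'n ^ 'n"
    using that unfolding symmetric_matrices_iff vector_add_component by metis
  show "c *\<^sub>R x \<in> symmetric_matrices" if "x \<in> symmetric_matrices" for c and x :: "real ^ 'n ^ 'n"
    using that unfolding symmetric_matrices_iff vector_scaleR_component by metis
qed

lemma sym_unit_symmetric: "sym_unit i j \<in> symmetric_matrices"
  unfolding symmetric_matrices_iff sym_unit_def vec_lambda_beta
  by (intro allI arg_cong2[where f = "(/)"] refl) (subst add.commute, simp add: conj_commute)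

text \<open>The matrices \<open>sym_unit i j\<close> are summed over ordered pairs, so that off-diagonal ones occur twice; this matches
  their normalisation by \<open>1/2\<close>.\<close>

lemma symmetric_matrix_expansion:
  fixes N :: "real ^ 'n ^ 'n"
  assumes "N \<in> symmetric_matrices"
  shows "(\<Sum>k\<in>UNIV. N $ fst k $ snd k *\<^sub>R sym_unit (fst k) (snd k)) = N"
proof -
  have sym: "N $ i $ j = N $ j $ i" for i j
    using assms unfolding symmetric_matrices_iff by blast
  have "(\<Sum>k\<in>UNIV. N $ fst k $ snd k *\<^sub>R sym_unit (fst k) (snd k)) $ a $ b = N $ a $ b" for a b
  proof -
    have "(\<Sum>k\<in>UNIV. N $ fst k $ snd k *\<^sub>R sym_unit (fst k) (snd k)) $ a $ b
        = (\<Sum>i\<in>UNIV. \<Sum>j\<in>UNIV. N $ i $ j * (sym_unit i j $ a $ b))"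
      by (simp add: sum.cartesian_product case_prod_beta flip: UNIV_Times_UNIV)
    also have "\<dots> = (\<Sum>i\<in>UNIV. \<Sum>j\<in>UNIV. (if i = a then if j = b then N $ i $ j / 2 else 0 else 0))
        + (\<Sum>i\<in>UNIV. \<Sum>j\<in>UNIV. (if j = a then if i = b then N $ i $ j / 2 else 0 else 0))"
      unfolding sum.distrib[symmetric]
      by (intro sum.cong refl) (auto simp: sym_unit_def)
    also have "(\<Sum>i\<in>UNIV. \<Sum>j\<in>UNIV. (if i = a then if j = b then N $ i $ j / 2 else 0 else 0)) = N $ a $ b / 2"
    proof -
      have "(\<Sum>j\<in>UNIV. (if i = a then if j = b then N $ i $ j / 2 else 0 else 0))
          = (if i = a then N $ a $ b / 2 else 0)" for i
        by simp
      then show ?thesis by simp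
    qed
    also have "(\<Sum>i\<in>UNIV. \<Sum>j\<in>UNIV. (if j = a then if i = b then N $ i $ j / 2 else 0 else 0)) = N $ a $ b / 2"
      by (simp add: sym[of b a])
    finally show ?thesis by simp
  qed
  then show ?thesis by (simp add: vec_eq_iff)
qed

lemma compact_positive_lower_bound:
  fixes f :: "'a::topological_space \<Rightarrow> real"
  assumes "compact S" "continuous_on S f" "\<And>x. x \<in> S \<Longrightarrow> 0 < f x"
  obtains m where "0 < m" "\<And>x. x \<in> S \<Longrightarrow> m \<le> f x"
proof (cases "S = {}")
  case True
  then show ?thesis using that[of 1] by auto
next
  case False
  then obtain a where "a \<in> S" "\<forall>x\<in>S. f a \<le> f x"
    using continuous_attains_inf[OF assms(1) _ assms(2)] by blast
  then show ?thesis using that[of "f a"] assms(3) by blast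
qed

text \<open>The matrix \<open>\<alpha> y \<otimes> y - \<beta> I\<close>: the shape of the Hessian of any radial function.\<close>

definition rank_one_minus_scalar :: "real \<Rightarrow> real ^ 'n \<Rightarrow> real \<Rightarrow> real ^ 'n ^ 'n" where
  "rank_one_minus_scalar \<alpha> y \<beta> = (\<chi> i j. \<alpha> * (y $ i * y $ j) - (if i = j then \<beta> else 0))"

lemma rank_one_minus_scalar_symmetric: "rank_one_minus_scalar \<alpha> y \<beta> \<in> symmetric_matrices"
  unfolding symmetric_matrices_iff by (auto simp: rank_one_minus_scalar_def mult.commute)

lemma abs_component_prod_le: "\<bar>(y :: real ^ 'n) $ i * y $ j\<bar> \<le> (norm y)\<^sup>2"
  unfolding abs_mult power2_eq_square
  by (intro mult_mono component_le_norm_cart) auto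

lemma rank_one_minus_scalar_entry:
  assumes "0 \<le> \<alpha>" "0 \<le> \<beta>"
  shows "\<bar>rank_one_minus_scalar \<alpha> y \<beta> $ i $ j\<bar> \<le> \<alpha> * (norm y)\<^sup>2 + (if i = j then \<beta> else 0)"
proof -
  have "\<bar>\<alpha> * (y $ i * y $ j)\<bar> \<le> \<alpha> * (norm y)\<^sup>2"
    unfolding abs_mult[of \<alpha>] using assms mult_left_mono[OF abs_component_prod_le[of y i j], of \<alpha>] by simp
  then show ?thesis
    unfolding rank_one_minus_scalar_def vec_lambda_beta
    using abs_triangle_ineq4[of "\<alpha> * (y $ i * y $ j)" "if i = j then \<beta> else 0"] assms(2)
    by (simp split: if_splits)
qed

text \<open>The pairing of the matrix with the coefficients \<open>\<partial>F/\<partial>M\<^sub>i\<^sub>j\<close>, in which ellipticity acts on the rank one part.\<close>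

lemma rank_one_minus_scalar_trace:
  fixes M :: "real ^ 'n ^ 'n"
  shows "(\<Sum>k\<in>UNIV. rank_one_minus_scalar \<alpha> y \<beta> $ fst k $ snd k * M $ fst k $ snd k)
    = \<alpha> * (y \<bullet> (M *v y)) - \<beta> * (\<Sum>i\<in>UNIV. M $ i $ i)"
proof -
  have "(\<Sum>k\<in>UNIV. rank_one_minus_scalar \<alpha> y \<beta> $ fst k $ snd k * M $ fst k $ snd k)
      = (\<Sum>i\<in>UNIV. \<Sum>j\<in>UNIV. rank_one_minus_scalar \<alpha> y \<beta> $ i $ j * M $ i $ j)"
    by (simp add: sum.cartesian_product case_prod_beta flip: UNIV_Times_UNIV)
  also have "\<dots> = (\<Sum>i\<in>UNIV. \<Sum>j\<in>UNIV. \<alpha> * (y $ i * (M $ i $ j * y $ j)) - (if i = j then \<beta> * M $ i $ j else 0))"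
    by (intro sum.cong refl) (auto simp: rank_one_minus_scalar_def algebra_simps)
  also have "\<dots> = \<alpha> * (y \<bullet> (M *v y)) - \<beta> * (\<Sum>i\<in>UNIV. M $ i $ i)"
    by (simp add: sum_subtractf inner_vec_def matrix_vector_mult_def sum_distrib_left)
  finally show ?thesis .
qed

text \<open>A quantitative linearisation of \<open>F\<close> at the jets of \<open>v\<close>, with constants uniform over the compact set \<open>K\<close>.
  The jets within distance \<open>1\<close> of those of \<open>v\<close> over \<open>K\<close> form a compact set \<open>Q\<close>, on which the first derivatives
  of \<open>F\<close> are bounded and \<open>\<partial>F/\<partial>M\<close> is uniformly continuous; at the jets of \<open>v\<close> the least eigenvalue of \<open>\<partial>F/\<partial>M\<close> is at
  least some \<open>l0 > 0\<close>.  The increment in \<open>s\<close> and \<open>p\<close> is estimated by Lipschitz bounds.  The increment in \<open>M\<close> is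
  compared with \<open>\<partial>F/\<partial>M\<close> at the jet of \<open>v\<close>, the error in the coefficients being kept so small that it costs at
  most half of the ellipticity in the rank one direction.\<close>

lemma linearised_lower_bound:
  fixes A K :: "('n::finite) spacetime set" and F :: "'n operator"
  assumes A: "openin (top_of_set {z. snd z \<le> T}) A" and K: "compact K" "K \<subseteq> A"
    and C1: "C1_operator A F" and ell: "elliptic_operator A F" and C2: "C2_on A v"
  obtains l \<kappa> \<rho> where "l > 0" "\<kappa> > 0" "\<rho> > 0"
    "\<And>z \<sigma> b \<alpha> y \<beta>. z \<in> K \<Longrightarrow> 0 \<le> \<alpha> \<Longrightarrow> 0 \<le> \<beta> \<Longrightarrow> \<bar>\<sigma>\<bar> \<le> \<rho> \<Longrightarrow> norm b \<le> \<rho> \<Longrightarrow> \<alpha> * (norm y)\<^sup>2 + \<beta> \<le> \<rho> \<Longrightarrow>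
      l * \<alpha> * (norm y)\<^sup>2 - \<kappa> * (\<beta> + norm b + \<bar>\<sigma>\<bar>)
      \<le> F z (v z + \<sigma>) (space_grad v z + b) (space_hess v z + rank_one_minus_scalar \<alpha> y \<beta>)
        - F z (v z) (space_grad v z) (space_hess v z)"
proof -
  define n where "n = real CARD('n)"
  have n: "1 \<le> n" unfolding n_def by (simp add: Suc_leI)
  \<comment> \<open>Compact set of arguments of \<open>F\<close>: all perturbations of size at most \<open>1\<close> of the jets of \<open>v\<close> over \<open>K\<close>.\<close>
  define Q where "Q = (\<lambda>(z, \<sigma>, b, N). (z, v z + \<sigma>, space_grad v z + b, space_hess v z + N)) `
    (K \<times> cball 0 1 \<times> cball 0 1 \<times> (cball 0 1 \<inter> symmetric_matrices))"
  note jet = C2_on_continuous_jet[OF A C2, THEN continuous_on_subset, OF K(2)]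
  have "compact Q"
    unfolding Q_def
  proof (rule compact_continuous_image)
    have 1: "continuous_on (K \<times> X) (\<lambda>q. g (fst q))" if "continuous_on K g"
      for X :: "(real \<times> (real ^ 'n) \<times> (real ^ 'n ^ 'n)) set" and g :: "'n spacetime \<Rightarrow> 'b::topological_space"
      by (rule continuous_on_compose2[OF that continuous_on_fst[OF continuous_on_id]]) auto
    show "continuous_on (K \<times> cball 0 1 \<times> cball 0 1 \<times> (cball 0 1 \<inter> symmetric_matrices))
        (\<lambda>(z, \<sigma>, b, N). (z, v z + \<sigma>, space_grad v z + b, space_hess v z + N))"
      unfolding case_prod_beta
      by (intro continuous_on_Pair continuous_on_add 1 jet continuous_on_id
          continuous_on_fst continuous_on_snd)
    show "compact (K \<times> cball (0 :: real) 1 \<times> cball (0 :: real ^ 'n) 1 \<times>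
        (cball (0 :: real ^ 'n ^ 'n) 1 \<inter> symmetric_matrices))"
      by (intro compact_Times K(1) compact_cball compact_Int_closed closed_subspace
          subspace_symmetric_matrices)
  qed
  have hess_sym: "space_hess v z \<in> symmetric_matrices" if "z \<in> K" for z
    using space_hess_symmetric[OF A _ C2] that K(2) by blast
  have Q_dom: "Q \<subseteq> operator_domain A"
    using K(2) by (auto simp: Q_def operator_domain_def intro!: subspace_add[OF subspace_symmetric_matrices] hess_sym)
  have in_Q: "(z, s, p, M) \<in> Q"
    if "z \<in> K" "\<bar>s - v z\<bar> \<le> 1" "norm (p - space_grad v z) \<le> 1" "norm (M - space_hess v z) \<le> 1"
      "M - space_hess v z \<in> symmetric_matrices" for z s p M
  proof -
    have "(z, s, p, M) = (\<lambda>(z, \<sigma>, b, N). (z, v z + \<sigma>, space_grad v z + b, space_hess v z + N))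
        (z, s - v z, p - space_grad v z, M - space_hess v z)"
      by simp
    moreover have "(z, s - v z, p - space_grad v z, M - space_hess v z)
        \<in> K \<times> cball 0 1 \<times> cball 0 1 \<times> (cball 0 1 \<inter> symmetric_matrices)"
      using that by simp
    ultimately show ?thesis unfolding Q_def by (rule image_eqI)
  qed
  define Fs where "Fs = (\<lambda>(z, s, p, M). F_s F z s p M)"
  define Fp where "Fp = (\<lambda>(z, s, p, M). F_p F z s p M)"
  define FM where "FM = (\<lambda>(z, s, p, M). F_M F z s p M)"
  have cont: "continuous_on Q Fs" "continuous_on Q Fp" "continuous_on Q FM"
    using C1 Q_dom unfolding C1_operator_def Fs_def Fp_def FM_def
    by (auto intro: continuous_on_subset)
  obtain \<kappa>1 where \<kappa>1: "\<And>q. q \<in> Q \<Longrightarrow> norm (Fs q) \<le> \<kappa>1"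
    using compact_imp_bounded[OF compact_continuous_image[OF cont(1) \<open>compact Q\<close>]]
    by (auto simp: bounded_iff)
  obtain \<kappa>2 where \<kappa>2: "\<And>q. q \<in> Q \<Longrightarrow> norm (Fp q) \<le> \<kappa>2"
    using compact_imp_bounded[OF compact_continuous_image[OF cont(2) \<open>compact Q\<close>]]
    by (auto simp: bounded_iff)
  obtain \<kappa>3 where \<kappa>3: "\<And>q. q \<in> Q \<Longrightarrow> norm (FM q) \<le> \<kappa>3"
    using compact_imp_bounded[OF compact_continuous_image[OF cont(3) \<open>compact Q\<close>]]
    by (auto simp: bounded_iff)
  define \<kappa>0 where "\<kappa>0 = max 0 (max \<kappa>1 (max \<kappa>2 \<kappa>3))"
  have \<kappa>0: "0 \<le> \<kappa>0" "\<And>q. q \<in> Q \<Longrightarrow> \<bar>Fs q\<bar> \<le> \<kappa>0" "\<And>q i. q \<in> Q \<Longrightarrow> \<bar>Fp q $ i\<bar> \<le> \<kappa>0"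
    "\<And>q i j. q \<in> Q \<Longrightarrow> \<bar>FM q $ i $ j\<bar> \<le> \<kappa>0"
  proof -
    show "0 \<le> \<kappa>0" by (simp add: \<kappa>0_def)
    show "\<bar>Fs q\<bar> \<le> \<kappa>0" if "q \<in> Q" for q
      using \<kappa>1[OF that] by (simp add: \<kappa>0_def)
    show "\<bar>Fp q $ i\<bar> \<le> \<kappa>0" if "q \<in> Q" for q i
      using \<kappa>2[OF that] component_le_norm_cart[of "Fp q" i] by (simp add: \<kappa>0_def)
    show "\<bar>FM q $ i $ j\<bar> \<le> \<kappa>0" if "q \<in> Q" for q i j
      using \<kappa>3[OF that] component_le_norm_cart[of "FM q $ i" j] Finite_Cartesian_Product.norm_nth_le[of "FM q" i]
      by (simp add: \<kappa>0_def)
  qed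
  define J where "J = (\<lambda>z. (z, v z, space_grad v z, space_hess v z))"
  have J_Q: "J z \<in> Q" if "z \<in> K" for z
    unfolding J_def using that subspace_0[OF subspace_symmetric_matrices] by (intro in_Q) auto
  obtain l0 where l0: "0 < l0" "\<And>z \<xi>. z \<in> K \<Longrightarrow> norm \<xi> = 1 \<Longrightarrow> l0 \<le> \<xi> \<bullet> (FM (J z) *v \<xi>)"
  proof -
    have contJ: "continuous_on K (\<lambda>z. FM (J z))"
      by (rule continuous_on_compose2[OF cont(3)])
        (use jet J_Q in \<open>auto simp: J_def intro!: continuous_on_Pair continuous_on_id\<close>)
    have *: "compact (K \<times> sphere (0 :: real ^ 'n) 1)"
      by (intro compact_Times K(1) compact_sphere)
    have "continuous_on (K \<times> sphere 0 1) (\<lambda>q. snd q \<bullet> (FM (J (fst q)) *v snd q))"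
    proof -
      have "continuous_on (K \<times> sphere 0 1) (\<lambda>q :: 'n spacetime \<times> (real ^ 'n). FM (J (fst q)))"
        by (rule continuous_on_compose2[OF contJ continuous_on_fst[OF continuous_on_id]]) auto
      then show ?thesis
        by (simp add: inner_vec_def matrix_vector_mult_def)
          (intro continuous_on_sum continuous_on_mult continuous_on_component
            continuous_on_snd continuous_on_id)
    qed
    moreover have "0 < snd q \<bullet> (FM (J (fst q)) *v snd q)" if "q \<in> K \<times> sphere 0 1" for q
    proof -
      have "J (fst q) \<in> operator_domain A" using that J_Q Q_dom by auto
      then have "positive_definite (FM (J (fst q)))"
        using ell unfolding elliptic_operator_def FM_def by (auto split: prod.splits)
      moreover have "snd q \<noteq> 0" using that by auto
      ultimately show ?thesis unfolding positive_definite_def by blast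
    qed
    ultimately obtain m where "0 < m" "\<And>q. q \<in> K \<times> sphere 0 1 \<Longrightarrow> m \<le> snd q \<bullet> (FM (J (fst q)) *v snd q)"
      using compact_positive_lower_bound[OF *] by blast
    then show ?thesis using that[of m] by (metis SigmaI fst_conv snd_conv mem_sphere_0)
  qed
  have ellip: "l0 * (norm y)\<^sup>2 \<le> y \<bullet> (FM (J z) *v y)" if "z \<in> K" for z y
  proof (cases "y = 0")
    case False
    define \<xi> where "\<xi> = y /\<^sub>R norm y"
    have "norm \<xi> = 1" and y: "y = norm y *\<^sub>R \<xi>" using False by (auto simp: \<xi>_def)
    then have "l0 * (norm y)\<^sup>2 \<le> (\<xi> \<bullet> (FM (J z) *v \<xi>)) * (norm y)\<^sup>2"
      using l0(2)[OF that] by (intro mult_right_mono) auto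
    also have "\<dots> = (norm y *\<^sub>R \<xi>) \<bullet> (FM (J z) *v (norm y *\<^sub>R \<xi>))"
      by (simp add: matrix_vector_mult_scaleR power2_eq_square)
    finally show ?thesis using y by simp
  qed simp
  \<comment> \<open>Admissible oscillation of \<open>\<partial>F/\<partial>M\<close>: the entries of the increment add up to at most \<open>n\<^sup>2 (\<alpha> |y|\<^sup>2 + \<beta>)\<close>, so the error
    stays below half of \<open>l0 (\<alpha> |y|\<^sup>2 + \<beta>)\<close>.\<close>
  define \<eta> where "\<eta> = l0 / (2 * n\<^sup>2)"
  have \<eta>: "0 < \<eta>" using l0(1) n by (simp add: \<eta>_def)
  obtain r where r: "0 < r" "\<And>q q'. q \<in> Q \<Longrightarrow> q' \<in> Q \<Longrightarrow> dist q' q < r \<Longrightarrow> dist (FM q') (FM q) < \<eta>"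
    using compact_uniformly_continuous[OF cont(3) \<open>compact Q\<close>, unfolded uniformly_continuous_on_def,
        rule_format, OF \<eta>] by blast
  define B where "B = (\<Sum>k\<in>UNIV. norm (sym_unit (fst k) (snd k) :: real ^ 'n ^ 'n))"
  have B: "0 \<le> B" unfolding B_def by (intro sum_nonneg) auto
  \<comment> \<open>Increments of size \<open>\<rho>\<close> move a jet by less than \<open>1\<close>, so that it stays in \<open>Q\<close>, and its matrix part by less than \<open>r\<close>.\<close>
  define \<rho> where "\<rho> = min 1 (r / 2) / (B + n)"
  have \<rho>: "0 < \<rho>" "\<rho> * B \<le> 1" "\<rho> * B < r" "\<rho> * n \<le> 1" "\<rho> \<le> 1"
  proof -
    have Bn: "0 < B + n" using B n by simp
    show "0 < \<rho>" using r(1) Bn by (simp add: \<rho>_def)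
    have "\<rho> * (B + n) = min 1 (r / 2)" using Bn by (simp add: \<rho>_def)
    moreover have "\<rho> * B \<le> \<rho> * (B + n)" "\<rho> * n \<le> \<rho> * (B + n)" "\<rho> * 1 \<le> \<rho> * n"
      using \<open>0 < \<rho>\<close> n B by (auto intro!: mult_left_mono)
    ultimately show "\<rho> * B \<le> 1" "\<rho> * B < r" "\<rho> * n \<le> 1" "\<rho> \<le> 1"
      using r(1) by (auto simp: min_def split: if_splits)
  qed
  show ?thesis
  proof (rule that[of "l0 / 2" "n * \<kappa>0 + l0" \<rho>])
    show "0 < l0 / 2" "0 < n * \<kappa>0 + l0" "0 < \<rho>"
      using l0(1) \<kappa>0(1) n \<rho>(1) by (auto intro: add_nonneg_pos)
  next
    fix z \<sigma> and b y :: "real ^ 'n" and \<alpha> \<beta> :: real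
    assume z: "z \<in> K" and \<alpha>: "0 \<le> \<alpha>" and \<beta>: "0 \<le> \<beta>" and \<sigma>: "\<bar>\<sigma>\<bar> \<le> \<rho>" and b: "norm b \<le> \<rho>"
      and small: "\<alpha> * (norm y)\<^sup>2 + \<beta> \<le> \<rho>"
    define N where "N = rank_one_minus_scalar \<alpha> y \<beta>"
    define s p M where "s = v z" and "p = space_grad v z" and "M = space_hess v z"
    have zA: "z \<in> A" using z K(2) by blast
    have N: "N \<in> symmetric_matrices" unfolding N_def by (rule rank_one_minus_scalar_symmetric)
    have M: "M \<in> symmetric_matrices" unfolding M_def by (rule hess_sym[OF z])
    define c where "c = (\<lambda>k. N $ fst k $ snd k)"
    have N_sum: "(\<Sum>k\<in>UNIV. c k *\<^sub>R sym_unit (fst k) (snd k)) = N"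
      unfolding c_def by (rule symmetric_matrix_expansion[OF N])
    have c_le: "\<bar>c k\<bar> \<le> \<rho>" for k
      using rank_one_minus_scalar_entry[OF \<alpha> \<beta>, of y "fst k" "snd k"] small \<beta>
      by (auto simp: c_def N_def split: if_splits)
    have c_norm: "(\<Sum>k\<in>UNIV. \<bar>c k\<bar> * norm (sym_unit (fst k) (snd k) :: real ^ 'n ^ 'n)) \<le> \<rho> * B"
      unfolding B_def sum_distrib_left by (intro sum_mono mult_right_mono c_le) simp
    have N_norm: "norm N \<le> 1"
    proof -
      have "norm N \<le> (\<Sum>k\<in>UNIV. norm (c k *\<^sub>R sym_unit (fst k) (snd k) :: real ^ 'n ^ 'n))"
        unfolding N_sum[symmetric] by (rule norm_sum)
      also have "\<dots> \<le> 1" using c_norm \<rho>(2) by simp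
      finally show ?thesis .
    qed
    have b_sum: "(\<Sum>i\<in>UNIV. \<bar>b $ i\<bar>) \<le> n * norm b"
      using sum_mono[of UNIV "\<lambda>i. \<bar>b $ i\<bar>" "\<lambda>_. norm b"] component_le_norm_cart[of b]
      by (simp add: n_def)
    have b1: "(\<Sum>i\<in>UNIV. \<bar>b $ i\<bar>) \<le> 1"
    proof -
      have "n * norm b \<le> n * \<rho>" using b n by (intro mult_left_mono) auto
      then show ?thesis using b_sum \<rho>(4) by (simp add: mult.commute)
    qed
    have diff: "(\<lambda>r. F z r p' M') differentiable (at s')"
      "(\<lambda>h. F z s' (p' + h *\<^sub>R axis i 1) M') differentiable (at 0)"
      "(\<lambda>h. F z s' p' (M' + h *\<^sub>R sym_unit i j)) differentiable (at 0)"
      if "M' \<in> symmetric_matrices" for s' p' M' i j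
      using C1 zA that unfolding C1_operator_def operator_domain_def by auto
    have step_s: "\<bar>F z (s + \<sigma>) (p + b) (M + N) - F z s (p + b) (M + N)\<bar> \<le> \<kappa>0 * \<bar>\<sigma>\<bar>"
    proof -
      have near: "(z, x, p + b, M + N) \<in> Q" if "\<bar>x - s\<bar> \<le> \<bar>\<sigma>\<bar>" for x
        using that \<sigma> b \<rho>(5) N N_norm z by (intro in_Q) (auto simp: s_def p_def M_def)
      have "\<bar>F z (s + (\<Sum>i\<in>{()}. \<sigma> *\<^sub>R 1)) (p + b) (M + N) - F z s (p + b) (M + N) - (\<Sum>i\<in>{()}. \<sigma> * 0)\<bar>
          \<le> \<kappa>0 * (\<Sum>i\<in>{()}. \<bar>\<sigma>\<bar>)"
      proof (rule increment_along_directions[where V = UNIV and g = "\<lambda>x _. F_s F z x (p + b) (M + N)"])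
        show "((\<lambda>h. F z (x + h *\<^sub>R 1) (p + b) (M + N)) has_real_derivative F_s F z x (p + b) (M + N)) (at 0)" for x
        proof -
          have "((\<lambda>r. F z r (p + b) (M + N)) has_real_derivative F_s F z x (p + b) (M + N)) (at x)"
            unfolding F_s_def DERIV_deriv_iff_real_differentiable
            by (rule diff) (rule subspace_add[OF subspace_symmetric_matrices M N])
          then show ?thesis
            using DERIV_shift[of "\<lambda>r. F z r (p + b) (M + N)" _ 0 x] by (simp add: add.commute)
        qed
        show "\<bar>F_s F z x (p + b) (M + N) - 0\<bar> \<le> \<kappa>0"
          if "norm (x - s) \<le> (\<Sum>i\<in>{()}. \<bar>\<sigma>\<bar> * norm (1 :: real))" for x
          using \<kappa>0(2)[OF near[of x]] that by (simp add: Fs_def)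
      qed auto
      then show ?thesis by simp
    qed
    have step_p: "\<bar>F z s (p + b) (M + N) - F z s p (M + N)\<bar> \<le> \<kappa>0 * (n * norm b)"
    proof -
      have near: "(z, s, x, M + N) \<in> Q" if "norm (x - p) \<le> (\<Sum>i\<in>UNIV. \<bar>b $ i\<bar> * norm (axis i 1 :: real ^ 'n))" for x
        using that b1 N N_norm z by (intro in_Q) (auto simp: s_def p_def M_def norm_axis_1)
      have "(\<Sum>i\<in>UNIV. b $ i *\<^sub>R axis i 1) = b"
        using basis_expansion[of b] by (simp add: scalar_mult_eq_scaleR)
      moreover have "\<bar>F z s (p + (\<Sum>i\<in>UNIV. b $ i *\<^sub>R axis i 1)) (M + N) - F z s p (M + N) - (\<Sum>i\<in>UNIV. b $ i * 0)\<bar>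
          \<le> \<kappa>0 * (\<Sum>i\<in>UNIV. \<bar>b $ i\<bar>)"
      proof (rule increment_along_directions[where V = UNIV and g = "\<lambda>x i. F_p F z s x (M + N) $ i"])
        show "((\<lambda>h. F z s (x + h *\<^sub>R axis i 1) (M + N)) has_real_derivative F_p F z s x (M + N) $ i) (at 0)" for x i
          unfolding F_p_def vec_lambda_beta DERIV_deriv_iff_real_differentiable
          by (rule diff) (rule subspace_add[OF subspace_symmetric_matrices M N])
        show "\<bar>F_p F z s x (M + N) $ i - 0\<bar> \<le> \<kappa>0"
          if "norm (x - p) \<le> (\<Sum>i\<in>UNIV. \<bar>b $ i\<bar> * norm (axis i 1 :: real ^ 'n))" for x i
          using \<kappa>0(3)[OF near[OF that]] by (simp add: Fp_def)
      qed auto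
      ultimately have "\<bar>F z s (p + b) (M + N) - F z s p (M + N)\<bar> \<le> \<kappa>0 * (\<Sum>i\<in>UNIV. \<bar>b $ i\<bar>)"
        by simp
      also have "\<dots> \<le> \<kappa>0 * (n * norm b)"
        using b_sum \<kappa>0(1) by (rule mult_left_mono)
      finally show ?thesis .
    qed
    have step_M: "\<bar>F z s p (M + N) - F z s p M - (\<Sum>k\<in>UNIV. c k * FM (J z) $ fst k $ snd k)\<bar>
        \<le> \<eta> * (\<Sum>k\<in>UNIV. \<bar>c k\<bar>)"
    proof -
      have "\<bar>F z s p (M + (\<Sum>k\<in>UNIV. c k *\<^sub>R sym_unit (fst k) (snd k))) - F z s p M
          - (\<Sum>k\<in>UNIV. c k * FM (J z) $ fst k $ snd k)\<bar> \<le> \<eta> * (\<Sum>k\<in>UNIV. \<bar>c k\<bar>)"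
      proof (rule increment_along_directions[where V = symmetric_matrices
            and g = "\<lambda>x k. F_M F z s p x $ fst k $ snd k"])
        show "subspace (symmetric_matrices :: (real ^ 'n ^ 'n) set)"
          by (rule subspace_symmetric_matrices)
        fix x :: "real ^ 'n ^ 'n" and k :: "'n \<times> 'n"
        assume x: "x - M \<in> symmetric_matrices"
          "norm (x - M) \<le> (\<Sum>k\<in>UNIV. \<bar>c k\<bar> * norm (sym_unit (fst k) (snd k) :: real ^ 'n ^ 'n))"
        have "x \<in> symmetric_matrices"
          using subspace_add[OF subspace_symmetric_matrices x(1) M] by simp
        then show "((\<lambda>h. F z s p (x + h *\<^sub>R sym_unit (fst k) (snd k))) has_real_derivative
            F_M F z s p x $ fst k $ snd k) (at 0)"
          unfolding F_M_def vec_lambda_beta DERIV_deriv_iff_real_differentiable by (rule diff)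
        have "(z, s, p, x) \<in> Q"
          using x c_norm \<rho>(2) z by (intro in_Q) (auto simp: s_def p_def M_def)
        moreover have "dist (z, s, p, x) (J z) < r"
          using x(2) c_norm \<rho>(3)
          by (simp add: J_def s_def p_def M_def dist_Pair_Pair dist_norm)
        ultimately have "dist (FM (z, s, p, x)) (FM (J z)) < \<eta>"
          by (intro r(2) J_Q z)
        moreover have "\<bar>(FM (z, s, p, x) - FM (J z)) $ fst k $ snd k\<bar> \<le> norm (FM (z, s, p, x) - FM (J z))"
          by (rule order_trans[OF component_le_norm_cart Finite_Cartesian_Product.norm_nth_le])
        ultimately show "\<bar>F_M F z s p x $ fst k $ snd k - FM (J z) $ fst k $ snd k\<bar> \<le> \<eta>"
          by (simp add: dist_norm FM_def)
      qed (auto simp: sym_unit_symmetric)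
      then show ?thesis unfolding N_sum .
    qed
    have trace: "l0 * (\<alpha> * (norm y)\<^sup>2) - \<beta> * (n * \<kappa>0) \<le> (\<Sum>k\<in>UNIV. c k * FM (J z) $ fst k $ snd k)"
    proof -
      have "(\<Sum>i\<in>UNIV. FM (J z) $ i $ i) \<le> (\<Sum>i\<in>(UNIV :: 'n set). \<kappa>0)"
        by (intro sum_mono) (use \<kappa>0(4)[OF J_Q[OF z]] in \<open>auto simp: abs_le_iff\<close>)
      then have "\<beta> * (\<Sum>i\<in>UNIV. FM (J z) $ i $ i) \<le> \<beta> * (n * \<kappa>0)"
        using \<beta> by (intro mult_left_mono) (auto simp: n_def)
      moreover have "\<alpha> * (l0 * (norm y)\<^sup>2) \<le> \<alpha> * (y \<bullet> (FM (J z) *v y))"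
        using ellip[OF z] \<alpha> by (intro mult_left_mono)
      ultimately show ?thesis
        unfolding c_def N_def rank_one_minus_scalar_trace mult.left_commute[of l0] by linarith
    qed
    have "\<eta> * (\<Sum>k\<in>UNIV. \<bar>c k\<bar>) \<le> l0 * (\<alpha> * (norm y)\<^sup>2) / 2 + l0 * \<beta> / 2"
    proof -
      have "(\<Sum>k\<in>UNIV. \<bar>c k\<bar>) = (\<Sum>i\<in>UNIV. \<Sum>j\<in>UNIV. \<bar>N $ i $ j\<bar>)"
        by (simp add: c_def sum.cartesian_product case_prod_beta flip: UNIV_Times_UNIV)
      also have "\<dots> \<le> (\<Sum>i\<in>(UNIV :: 'n set). \<Sum>j\<in>UNIV. \<alpha> * (norm y)\<^sup>2 + (if i = j then \<beta> else 0))"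
        unfolding N_def by (intro sum_mono rank_one_minus_scalar_entry \<alpha> \<beta>)
      also have "\<dots> = n\<^sup>2 * (\<alpha> * (norm y)\<^sup>2) + n * \<beta>"
        by (simp add: sum.distrib n_def power2_eq_square algebra_simps)
      also have "\<dots> \<le> n\<^sup>2 * (\<alpha> * (norm y)\<^sup>2) + n\<^sup>2 * \<beta>"
        using n \<beta> by (intro add_left_mono mult_right_mono) (auto simp: power2_eq_square)
      finally have "\<eta> * (\<Sum>k\<in>UNIV. \<bar>c k\<bar>) \<le> \<eta> * (n\<^sup>2 * (\<alpha> * (norm y)\<^sup>2) + n\<^sup>2 * \<beta>)"
        using \<eta> by (intro mult_left_mono) auto
      also have "\<dots> = l0 * (\<alpha> * (norm y)\<^sup>2) / 2 + l0 * \<beta> / 2"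
        using n by (simp add: \<eta>_def field_simps)
      finally show ?thesis .
    qed
    then have "l0 * (\<alpha> * (norm y)\<^sup>2) / 2 - \<beta> * (n * \<kappa>0) - l0 * \<beta> / 2 - \<kappa>0 * (n * norm b) - \<kappa>0 * \<bar>\<sigma>\<bar>
        \<le> F z (s + \<sigma>) (p + b) (M + N) - F z s p M"
      using step_s step_p step_M trace by linarith
    moreover have "\<kappa>0 * \<bar>\<sigma>\<bar> \<le> (n * \<kappa>0 + l0) * \<bar>\<sigma>\<bar>"
      using n \<kappa>0(1) l0(1) mult_right_mono[of 1 n \<kappa>0] by (intro mult_right_mono) auto
    moreover have "(n * \<kappa>0) * norm b \<le> (n * \<kappa>0 + l0) * norm b"
      using l0(1) by (intro mult_right_mono) auto
    moreover have "l0 * \<beta> / 2 \<le> l0 * \<beta>"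
      using l0(1) \<beta> by simp
    ultimately show "l0 / 2 * \<alpha> * (norm y)\<^sup>2 - (n * \<kappa>0 + l0) * (\<beta> + norm b + \<bar>\<sigma>\<bar>)
      \<le> F z (v z + \<sigma>) (space_grad v z + b) (space_hess v z + rank_one_minus_scalar \<alpha> y \<beta>)
        - F z (v z) (space_grad v z) (space_hess v z)"
      unfolding s_def p_def M_def N_def by (simp add: algebra_simps)
  qed
qed

section \<open>Lower semicontinuous functions\<close>

lemma lower_semicontinuous_on_subset:
  "lower_semicontinuous_on A f \<Longrightarrow> B \<subseteq> A \<Longrightarrow> lower_semicontinuous_on B f"
  unfolding lower_semicontinuous_on_def by (meson at_le filter_leD subsetD)

lemma lower_semicontinuous_on_add_continuous:
  assumes "lower_semicontinuous_on A f" and "continuous_on A g"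
  shows "lower_semicontinuous_on A (\<lambda>z. f z + g z)"
  unfolding lower_semicontinuous_on_def
proof (intro ballI allI impI)
  fix z c assume z: "z \<in> A" and c: "c < f z + g z"
  define d where "d = (f z + g z - c) / 2"
  have d: "d > 0" using c by (simp add: d_def)
  have "\<forall>\<^sub>F w in at z within A. f z - d < f w"
    using assms(1) z d unfolding lower_semicontinuous_on_def by simp
  moreover have "\<forall>\<^sub>F w in at z within A. g z - d < g w"
    using assms(2) z d unfolding continuous_on_def by (intro order_tendstoD(1)[of g "g z"]) auto
  ultimately show "\<forall>\<^sub>F w in at z within A. c < f w + g w"
    by eventually_elim (simp add: d_def field_simps)
qed

text \<open>If no point were minimal, the relatively open sets \<open>{f y < f w}\<close>, \<open>y \<in> D\<close>, would cover \<open>D\<close>; in a finite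
  subcover the \<open>y\<close> with the least value of \<open>f\<close> is not covered.\<close>

lemma lower_semicontinuous_attains_min:
  fixes f :: "'a::t2_space \<Rightarrow> real"
  assumes "compact D" "D \<noteq> {}" "lower_semicontinuous_on D f"
  obtains z where "z \<in> D" "\<And>w. w \<in> D \<Longrightarrow> f z \<le> f w"
proof -
  have "\<exists>z\<in>D. \<forall>w\<in>D. f z \<le> f w"
  proof (rule ccontr)
    assume "\<not> ?thesis"
    then have lower: "\<exists>y\<in>D. f y < f w" if "w \<in> D" for w
      using that by force
    define V where "V = (\<lambda>y. {w \<in> D. f y < f w})"
    have "openin (top_of_set D) (V y)" for y
    proof (subst openin_subopen, intro ballI)
      fix z assume z: "z \<in> V y"
      then have "\<forall>\<^sub>F w in at z within D. f y < f w"
        using assms(3) by (auto simp: V_def lower_semicontinuous_on_def)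
      then obtain O' where O': "open O'" "z \<in> O'" "\<And>w. w \<in> O' \<Longrightarrow> w \<noteq> z \<Longrightarrow> w \<in> D \<Longrightarrow> f y < f w"
        unfolding eventually_at_topological by blast
      show "\<exists>W. openin (top_of_set D) W \<and> z \<in> W \<and> W \<subseteq> V y"
        by (rule exI[of _ "D \<inter> O'"]) (use z O' in \<open>auto simp: V_def\<close>)
    qed
    moreover have "D \<subseteq> \<Union> (V ` D)"
      using lower by (auto simp: V_def)
    ultimately obtain \<C> where \<C>: "\<C> \<subseteq> V ` D" "finite \<C>" "D \<subseteq> \<Union> \<C>"
      using assms(1) unfolding compact_eq_openin_cover by (metis (no_types, lifting) imageE)
    obtain Y where Y: "Y \<subseteq> D" "finite Y" "\<C> = V ` Y"
      using finite_subset_image[OF \<C>(2,1)] by blast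
    have "Y \<noteq> {}" using \<C>(3) Y(3) assms(2) by auto
    then obtain y0 where y0: "y0 \<in> Y" "\<And>y. y \<in> Y \<Longrightarrow> f y0 \<le> f y"
      using Y(2) by (metis arg_min_if_finite(1) arg_min_least)
    then obtain y where "y \<in> Y" "y0 \<in> V y"
      using \<C>(3) Y by blast
    then show False using y0(2)[of y] by (simp add: V_def)
  qed
  then show ?thesis using that by blast
qed

section \<open>A moving bump that is a strict subsolution\<close>

text \<open>At time \<open>t\<close> only its values in the ball of radius \<open>R\<close> around \<open>a + (t - t1) V\<close> matter; on the boundary of this ball
  it vanishes to second order, so that its gradient is small there while its Hessian keeps a positive rank one part.\<close>

definition moving_bump ::
  "real \<Rightarrow> real \<Rightarrow> real \<Rightarrow> real ^ 'n \<Rightarrow> real ^ 'n \<Rightarrow> real \<Rightarrow> ('n::finite) spacetime \<Rightarrow> real" where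
  "moving_bump \<epsilon> \<gamma> R a V t1 w =
     \<epsilon> * exp (- \<gamma> * (snd w - t1)) * (R\<^sup>2 - (norm (fst w - a - (snd w - t1) *\<^sub>R V))\<^sup>2)\<^sup>2"

lemma C2_on_moving_bump:
  fixes a V :: "real ^ 'n::finite"
  shows "C2_on A (\<lambda>w. moving_bump \<epsilon> \<gamma> R a V t1 w + k)"
proof -
  have L: "bounded_linear (\<lambda>w :: 'n spacetime. fst w - snd w *\<^sub>R V)"
    by (intro bounded_linear_sub bounded_linear_fst bounded_linear_scaleR_const bounded_linear_snd)
  have eq: "fst w - a - (snd w - t1) *\<^sub>R V = fst w - snd w *\<^sub>R V + (t1 *\<^sub>R V - a)" for w :: "'n spacetime"
    by (simp add: algebra_simps)
  show ?thesis
    unfolding moving_bump_def power2_norm_eq_inner eq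
    by (intro C2_on_add C2_on_mult C2_on_exp C2_on_power2 C2_on_diff C2_on_const C2_on_inner_affine L
        C2_on_linear bounded_linear_snd)
qed

text \<open>The additive constant \<open>k\<close> is carried along because the bump is shifted vertically until it touches.\<close>

lemma moving_bump_jet:
  fixes w :: "('n::finite) spacetime" and a V :: "real ^ 'n" and \<epsilon> \<gamma> R t1 k :: real
  defines "y \<equiv> fst w - a - (snd w - t1) *\<^sub>R V" and "E \<equiv> \<epsilon> * exp (- \<gamma> * (snd w - t1))"
    and "q \<equiv> R\<^sup>2 - (norm (fst w - a - (snd w - t1) *\<^sub>R V))\<^sup>2"
  shows "space_grad (\<lambda>w. moving_bump \<epsilon> \<gamma> R a V t1 w + k) w = (- 4 * E * q) *\<^sub>R y"
    and "space_hess (\<lambda>w. moving_bump \<epsilon> \<gamma> R a V t1 w + k) w = rank_one_minus_scalar (8 * E) y (4 * E * q)"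
    and "time_deriv (\<lambda>w. moving_bump \<epsilon> \<gamma> R a V t1 w + k) w = E * (4 * q * (y \<bullet> V) - \<gamma> * q\<^sup>2)"
proof -
  let ?f = "\<lambda>w. moving_bump \<epsilon> \<gamma> R a V t1 w + k"
  let ?y = "\<lambda>w :: 'n spacetime. fst w - a - (snd w - t1) *\<^sub>R V"
  let ?E = "\<lambda>w :: 'n spacetime. \<epsilon> * exp (- \<gamma> * (snd w - t1))"
  have y_shift: "?y (w + h *\<^sub>R space_unit i) = ?y w + h *\<^sub>R axis i 1" for w h i
    by (simp add: algebra_simps)
  have norm_shift: "(norm (x + h *\<^sub>R axis i 1))\<^sup>2 = (norm x)\<^sup>2 + 2 * h * x $ i + h\<^sup>2"
    for x :: "real ^ 'n" and h i
    unfolding power2_norm_eq_inner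
    by (simp add: inner_add_left inner_add_right inner_axis inner_commute[of "axis i 1"] inner_axis_axis)
      (simp add: power2_eq_square algebra_simps)
  have grad: "space_grad ?f w $ i = - 4 * ?E w * (R\<^sup>2 - (norm (?y w))\<^sup>2) * ?y w $ i" for w i
  proof -
    have f_shift: "?f (w + h *\<^sub>R space_unit i)
        = ?E w * (R\<^sup>2 - ((norm (?y w))\<^sup>2 + 2 * h * ?y w $ i + h\<^sup>2))\<^sup>2 + k" for h
      unfolding moving_bump_def y_shift norm_shift by simp
    have "((\<lambda>h. ?f (w + h *\<^sub>R space_unit i)) has_real_derivative
        - 4 * ?E w * (R\<^sup>2 - (norm (?y w))\<^sup>2) * ?y w $ i) (at 0)"
    proof -
      have "((\<lambda>h. e * (c - (n + 2 * h * b + h\<^sup>2))\<^sup>2 + k) has_real_derivative - 4 * e * (c - n) * b) (at 0)"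
        for e c n b :: real
        by (auto intro!: derivative_eq_intros)
      then show ?thesis unfolding f_shift .
    qed
    then show ?thesis
      unfolding space_grad_def space_shift vec_lambda_beta by (rule DERIV_imp_deriv)
  qed
  show "space_grad ?f w = (- 4 * E * q) *\<^sub>R y"
    by (simp add: vec_eq_iff grad E_def q_def y_def)
  have q_y: "q = R\<^sup>2 - (norm y)\<^sup>2"
    by (simp add: q_def y_def)
  have "space_hess ?f w $ i $ j = rank_one_minus_scalar (8 * E) y (4 * E * q) $ i $ j" for i j
  proof -
    have grad_shift: "space_grad ?f (w + h *\<^sub>R space_unit j) $ i
        = - 4 * E * (R\<^sup>2 - ((norm y)\<^sup>2 + 2 * h * y $ j + h\<^sup>2)) * (y $ i + h * axis j 1 $ i)" for h
      unfolding grad y_shift norm_shift by (simp add: E_def y_def)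
    have "((\<lambda>h. space_grad ?f (w + h *\<^sub>R space_unit j) $ i) has_real_derivative
        rank_one_minus_scalar (8 * E) y (4 * E * q) $ i $ j) (at 0)"
      unfolding grad_shift
      by (auto intro!: derivative_eq_intros
          simp: rank_one_minus_scalar_def axis_def q_y algebra_simps)
    then show ?thesis
      unfolding space_hess_def space_shift vec_lambda_beta by (rule DERIV_imp_deriv)
  qed
  then show "space_hess ?f w = rank_one_minus_scalar (8 * E) y (4 * E * q)"
    by (simp add: vec_eq_iff)
  have line: "?f (fst w, \<tau>) = \<epsilon> * exp (- \<gamma> * (\<tau> - t1)) *
      (R\<^sup>2 - ((norm y)\<^sup>2 - 2 * (\<tau> - snd w) * (y \<bullet> V) + (\<tau> - snd w)\<^sup>2 * (V \<bullet> V)))\<^sup>2 + k" for \<tau>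
  proof -
    have "fst (fst w, \<tau>) - a - (snd (fst w, \<tau>) - t1) *\<^sub>R V = y - (\<tau> - snd w) *\<^sub>R V"
      by (simp add: y_def algebra_simps)
    moreover have "(norm (y - (\<tau> - snd w) *\<^sub>R V))\<^sup>2
        = (norm y)\<^sup>2 - 2 * (\<tau> - snd w) * (y \<bullet> V) + (\<tau> - snd w)\<^sup>2 * (V \<bullet> V)"
      unfolding power2_norm_eq_inner
      by (simp only: inner_diff_left inner_diff_right inner_scaleR_left inner_scaleR_right
          inner_commute[of V y]) (simp add: power2_eq_square algebra_simps)
    ultimately show ?thesis
      unfolding moving_bump_def by simp
  qed
  have "((\<lambda>\<tau>. ?f (fst w, \<tau>)) has_real_derivative E * (4 * q * (y \<bullet> V) - \<gamma> * q\<^sup>2))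
      (at (snd w) within {..snd w})"
    unfolding line
  proof (rule DERIV_cong)
    show "((\<lambda>\<tau>. \<epsilon> * exp (- \<gamma> * (\<tau> - t1)) * (R\<^sup>2 - ((norm y)\<^sup>2 - 2 * (\<tau> - snd w) * (y \<bullet> V)
        + (\<tau> - snd w)\<^sup>2 * (V \<bullet> V)))\<^sup>2 + k) has_real_derivative
        (\<epsilon> * (exp (- \<gamma> * (snd w - t1)) * - \<gamma>)) * (R\<^sup>2 - (norm y)\<^sup>2)\<^sup>2
        + \<epsilon> * exp (- \<gamma> * (snd w - t1)) * (2 * (R\<^sup>2 - (norm y)\<^sup>2) * (2 * (y \<bullet> V))))
      (at (snd w) within {..snd w})"
      by (auto intro!: derivative_eq_intros)
  qed (simp add: E_def q_def y_def algebra_simps)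
  then show "time_deriv ?f w = E * (4 * q * (y \<bullet> V) - \<gamma> * q\<^sup>2)"
    by (rule time_deriv_eqI)
qed

text \<open>With \<open>m = |y|\<close> and \<open>W = |V|\<close> the expression is, up to a positive factor, a lower bound for the linearised operator
  applied to the bump.  Since \<open>m \<le> R\<close> and \<open>q \<le> R\<^sup>2\<close>, it is at least \<open>X - B q + \<gamma> q\<^sup>2\<close> with \<open>X = 8 l R\<^sup>2 > 0\<close> and a constant
  \<open>B\<close> independent of \<open>\<gamma>\<close>, a quadratic in \<open>q\<close> that has no real zero once \<open>B\<^sup>2 < 4 X \<gamma>\<close>.\<close>

lemma bump_decay_rate_exists:
  fixes l \<kappa> R W :: real
  assumes "l > 0" "\<kappa> > 0" "R > 0" "W \<ge> 0"
  obtains \<gamma> where "\<gamma> > 0"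
    "\<And>m q. 0 \<le> m \<Longrightarrow> 0 \<le> q \<Longrightarrow> m\<^sup>2 = R\<^sup>2 - q \<Longrightarrow>
      0 < 8 * l * m\<^sup>2 - \<kappa> * (4 * q + 4 * q * m + q\<^sup>2) - 4 * q * m * W + \<gamma> * q\<^sup>2"
proof -
  define X where "X = 8 * l * R\<^sup>2"
  define B where "B = 8 * l + \<kappa> * (4 + 4 * R + R\<^sup>2) + 4 * R * W"
  have X: "X > 0" using assms by (simp add: X_def)
  have B: "B > 0" using assms by (simp add: B_def add_pos_nonneg)
  show ?thesis
  proof (rule that[of "B\<^sup>2 / (2 * X)"])
    show "B\<^sup>2 / (2 * X) > 0" using X B by simp
  next
    fix m q assume m: "0 \<le> m" and q: "0 \<le> q" and eq: "m\<^sup>2 = R\<^sup>2 - q"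
    have "m\<^sup>2 \<le> R\<^sup>2" using eq q by linarith
    then have mR: "m \<le> R" using power2_le_imp_le[of m R] assms(3) by simp
    have qR: "q \<le> R\<^sup>2" using eq zero_le_power2[of m] by linarith
    have "4 * q * m \<le> 4 * q * R" using mR q by (intro mult_left_mono) auto
    moreover have "q\<^sup>2 \<le> q * R\<^sup>2" using mult_left_mono[OF qR q] by (simp add: power2_eq_square)
    ultimately have 1: "\<kappa> * (4 * q + 4 * q * m + q\<^sup>2) \<le> \<kappa> * (4 * q + 4 * q * R + q * R\<^sup>2)"
      using assms(2) by (intro mult_left_mono) auto
    have 2: "4 * q * m * W \<le> 4 * q * R * W"
      using mR q assms(4) by (intro mult_right_mono mult_left_mono) auto
    define C where "C = B\<^sup>2 / (2 * X)"
    have C: "2 * X * C = B\<^sup>2" using X by (simp add: C_def)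
    \<comment> \<open>Completing the square.\<close>
    have "2 * X * (X - B * q + C * q\<^sup>2) = (X - B * q)\<^sup>2 + X\<^sup>2"
      by (simp add: distrib_left right_diff_distrib mult.assoc[symmetric] C power2_diff power_mult_distrib)
        (simp add: power2_eq_square)
    also have "\<dots> > 0" using X by (intro add_nonneg_pos) auto
    finally have "0 < X - B * q + C * q\<^sup>2"
      using X by (simp add: zero_less_mult_iff)
    also have "\<dots> = 8 * l * m\<^sup>2 - \<kappa> * (4 * q + 4 * q * R + q * R\<^sup>2) - 4 * q * R * W + C * q\<^sup>2"
      unfolding eq by (simp add: X_def B_def algebra_simps)
    finally show "0 < 8 * l * m\<^sup>2 - \<kappa> * (4 * q + 4 * q * m + q\<^sup>2) - 4 * q * m * W + B\<^sup>2 / (2 * X) * q\<^sup>2"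
      using 1 2 unfolding C_def by linarith
  qed
qed

section \<open>Propagation of contact\<close>

text \<open>The local situation: \<open>A\<close> stands for \<open>\<Omega> \<union> \<Sigma>\<close>, and interior points and points at the final time \<open>T\<close> are treated
  alike, because \<open>A\<close> is relatively open in \<open>{t \<le> T}\<close>.\<close>

locale touching_supersolution =
  fixes A :: "('n::finite) spacetime set" and T :: real and F :: "'n operator"
    and u v :: "'n spacetime \<Rightarrow> real"
  assumes rel_open: "openin (top_of_set {z. snd z \<le> T}) A"
    and cont_op: "continuous_operator A F" and C1_op: "C1_operator A F"
    and elliptic: "elliptic_operator A F"
    and v_le_u: "\<And>z. z \<in> A \<Longrightarrow> v z \<le> u z"
    and lsc_u: "lower_semicontinuous_on A u" and C2_v: "C2_on A v"
    and visc: "viscosity_ineq_on A F u v"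
begin

lemma lsc_gap: "lower_semicontinuous_on A (\<lambda>z. u z + - v z)"
  by (intro lower_semicontinuous_on_add_continuous lsc_u continuous_on_minus
      C2_on_continuous_jet(1)[OF rel_open C2_v])

lemma gap_lower_bound_near:
  assumes "z \<in> A" and "c < u z - v z"
  obtains s where "s > 0" "\<And>w. w \<in> A \<Longrightarrow> dist w z < s \<Longrightarrow> c < u w - v w"
proof -
  have "\<forall>\<^sub>F w in at z within A. c < u w + - v w"
    using lsc_gap assms unfolding lower_semicontinuous_on_def by simp
  then obtain s where s: "s > 0" "\<And>w. w \<in> A \<Longrightarrow> w \<noteq> z \<and> dist w z < s \<Longrightarrow> c < u w + - v w"
    unfolding eventually_at by blast
  show ?thesis
  proof (rule that[OF s(1)])
    show "c < u w - v w" if "w \<in> A" "dist w z < s" for w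
      using s(2)[OF that(1)] that(2) assms(2) by (cases "w = z") auto
  qed
qed

text \<open>The maximum principle behind the comparison.  Suppose that \<open>v\<close> plus the vertically shifted bump touches \<open>u\<close> from below
  at \<open>z\<close> although \<open>\<sigma> = u z - v z\<close> does not exceed the bump there.  The viscosity inequality says that passing
  from the jet of \<open>v\<close> to that of \<open>v\<close> plus the bump, with value \<open>u z\<close>, raises \<open>F\<close> by at most the time derivative
  of the bump; the linearisation bounds the same increment from below, the zero-order term being
  controlled by \<open>0 \<le> \<sigma> \<le> E q\<^sup>2\<close>.  For the rate \<open>\<gamma>\<close> found above the two bounds are incompatible.
  The rate \<open>\<gamma>\<close> must not depend on the amplitude \<open>\<epsilon>\<close>, which is chosen later and only has to be small.\<close>

lemma gap_exceeds_touching_bump: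
  assumes K: "compact K" "K \<subseteq> A" and R: "0 < R" "R \<le> 1"
  obtains \<gamma> \<epsilon>\<^sub>0 where "\<gamma> > 0" "\<epsilon>\<^sub>0 > 0"
    "\<And>\<epsilon> a t1 k U z. 0 < \<epsilon> \<Longrightarrow> \<epsilon> \<le> \<epsilon>\<^sub>0 \<Longrightarrow> open U \<Longrightarrow> z \<in> U \<Longrightarrow> z \<in> K \<Longrightarrow> t1 \<le> snd z \<Longrightarrow>
      norm (fst z - a - (snd z - t1) *\<^sub>R V) < R \<Longrightarrow>
      (\<And>w. w \<in> A \<inter> U \<Longrightarrow> v w + (moving_bump \<epsilon> \<gamma> R a V t1 w + k) \<le> u w) \<Longrightarrow>
      v z + (moving_bump \<epsilon> \<gamma> R a V t1 z + k) = u z \<Longrightarrow>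
      moving_bump \<epsilon> \<gamma> R a V t1 z < u z - v z"
proof -
  obtain l \<kappa> \<rho> where l: "l > 0" "\<kappa> > 0" "\<rho> > 0" and
    lin: "\<And>z \<sigma> b \<alpha> y \<beta>. z \<in> K \<Longrightarrow> 0 \<le> \<alpha> \<Longrightarrow> 0 \<le> \<beta> \<Longrightarrow> \<bar>\<sigma>\<bar> \<le> \<rho> \<Longrightarrow> norm b \<le> \<rho> \<Longrightarrow> \<alpha> * (norm y)\<^sup>2 + \<beta> \<le> \<rho> \<Longrightarrow>
      l * \<alpha> * (norm y)\<^sup>2 - \<kappa> * (\<beta> + norm b + \<bar>\<sigma>\<bar>)
      \<le> F z (v z + \<sigma>) (space_grad v z + b) (space_hess v z + rank_one_minus_scalar \<alpha> y \<beta>)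
        - F z (v z) (space_grad v z) (space_hess v z)"
    using linearised_lower_bound[OF rel_open K C1_op elliptic C2_v] by metis
  obtain \<gamma> where \<gamma>: "\<gamma> > 0" and rate: "\<And>m q. 0 \<le> m \<Longrightarrow> 0 \<le> q \<Longrightarrow> m\<^sup>2 = R\<^sup>2 - q \<Longrightarrow>
      0 < 8 * l * m\<^sup>2 - \<kappa> * (4 * q + 4 * q * m + q\<^sup>2) - 4 * q * m * norm V + \<gamma> * q\<^sup>2"
    using bump_decay_rate_exists[OF l(1,2) R(1), of "norm V"] by auto
  show ?thesis
  proof (rule that[of \<gamma> "\<rho> / 12"])
    show "\<gamma> > 0" "\<rho> / 12 > 0" using \<gamma> l(3) by simp_all
  next
    fix \<epsilon> a t1 k U and z :: "'n spacetime"
    assume \<epsilon>: "0 < \<epsilon>" "\<epsilon> \<le> \<rho> / 12" and U: "open U" "z \<in> U" and z: "z \<in> K" and t1: "t1 \<le> snd z"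
      and small: "norm (fst z - a - (snd z - t1) *\<^sub>R V) < R"
      and below: "\<And>w. w \<in> A \<inter> U \<Longrightarrow> v w + (moving_bump \<epsilon> \<gamma> R a V t1 w + k) \<le> u w"
      and touch: "v z + (moving_bump \<epsilon> \<gamma> R a V t1 z + k) = u z"
    define y where "y = fst z - a - (snd z - t1) *\<^sub>R V"
    define m where "m = norm y"
    define q where "q = R\<^sup>2 - m\<^sup>2"
    define E where "E = \<epsilon> * exp (- \<gamma> * (snd z - t1))"
    define \<sigma> where "\<sigma> = u z - v z"
    have zA: "z \<in> A" using z K(2) by blast
    have m: "0 \<le> m" "m < R" using small by (simp_all add: m_def y_def)
    have m2: "m\<^sup>2 < R\<^sup>2" using m by (intro power_strict_mono) auto
    have R2: "R\<^sup>2 \<le> 1" using R by (simp add: power_le_one)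
    have q: "0 < q" "q \<le> 1" using m2 R2 zero_le_power2[of m] unfolding q_def by linarith+
    have E: "0 < E" "E \<le> \<epsilon>"
      using \<epsilon>(1) \<gamma> t1 by (auto simp: E_def mult_le_cancel_left1)
    show "moving_bump \<epsilon> \<gamma> R a V t1 z < u z - v z"
    proof (rule ccontr)
      assume "\<not> ?thesis"
      then have \<sigma>_le: "\<sigma> \<le> E * q\<^sup>2"
        by (simp add: \<sigma>_def moving_bump_def E_def q_def m_def y_def)
      have \<sigma>_nonneg: "0 \<le> \<sigma>" using v_le_u[OF zA] by (simp add: \<sigma>_def)
      have visc_ineq: "F z (u z) (space_grad v z + (- 4 * E * q) *\<^sub>R y)
            (space_hess v z + rank_one_minus_scalar (8 * E) y (4 * E * q))
          - (time_deriv v z + E * (4 * q * (y \<bullet> V) - \<gamma> * q\<^sup>2))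
          \<le> F z (v z) (space_grad v z) (space_hess v z) - time_deriv v z"
      proof -
        let ?g = "\<lambda>w. moving_bump \<epsilon> \<gamma> R a V t1 w + k"
        have "F z (v z + ?g z) (space_grad (\<lambda>w. v w + ?g w) z) (space_hess (\<lambda>w. v w + ?g w) z)
            - time_deriv (\<lambda>w. v w + ?g w) z
            \<le> F z (v z) (space_grad v z) (space_hess v z) - time_deriv v z"
          by (rule one_sided_test_function[OF rel_open zA cont_op visc
                C2_on_add[OF C2_v C2_on_moving_bump] U below touch])
        then show ?thesis
          unfolding C2_on_add_jet[OF rel_open zA C2_v C2_on_moving_bump] moving_bump_jet touch
          by (simp add: y_def E_def q_def m_def)
      qed
      have lin_ineq: "l * (8 * E) * (norm y)\<^sup>2 - \<kappa> * (4 * E * q + norm ((- 4 * E * q) *\<^sub>R y) + \<bar>\<sigma>\<bar>)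
        \<le> F z (v z + \<sigma>) (space_grad v z + (- 4 * E * q) *\<^sub>R y)
            (space_hess v z + rank_one_minus_scalar (8 * E) y (4 * E * q))
          - F z (v z) (space_grad v z) (space_hess v z)"
      proof (rule lin[OF z])
        have Eq: "E * q \<le> \<epsilon>" using E q mult_mono[of E \<epsilon> q 1] by simp
        have Em: "E * m\<^sup>2 \<le> \<epsilon>" using E m2 R2 mult_mono[of E \<epsilon> "m\<^sup>2" 1] by simp
        have Eqm: "E * q * m \<le> \<epsilon>" using Eq m R E q mult_mono[of "E * q" \<epsilon> m 1] by simp
        have "q\<^sup>2 \<le> 1" using q by (simp add: power_le_one)
        then have "E * q\<^sup>2 \<le> \<epsilon>" using E mult_mono[of E \<epsilon> "q\<^sup>2" 1] by simp
        then show "\<bar>\<sigma>\<bar> \<le> \<rho>" using \<sigma>_le \<sigma>_nonneg \<epsilon> l(3) by linarith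
        show "norm ((- 4 * E * q) *\<^sub>R y) \<le> \<rho>"
          using Eqm \<epsilon> l(3) E q by (simp add: abs_mult flip: m_def)
        show "8 * E * (norm y)\<^sup>2 + 4 * E * q \<le> \<rho>"
          using Em Eq \<epsilon> by (simp flip: m_def)
        show "0 \<le> 8 * E" "0 \<le> 4 * E * q" using E q by simp_all
      qed
      have norm_b: "norm ((- 4 * E * q) *\<^sub>R y) = 4 * E * q * m"
        using E q by (simp add: abs_mult m_def)
      have sum: "v z + \<sigma> = u z" by (simp add: \<sigma>_def)
      have "l * (8 * E) * m\<^sup>2 - \<kappa> * (4 * E * q + 4 * E * q * m + \<sigma>) \<le> E * (4 * q * (y \<bullet> V) - \<gamma> * q\<^sup>2)"
        using visc_ineq lin_ineq
        unfolding norm_b sum abs_of_nonneg[OF \<sigma>_nonneg] m_def[symmetric] by linarith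
      moreover have "\<kappa> * (4 * E * q + 4 * E * q * m + \<sigma>) \<le> \<kappa> * (4 * E * q + 4 * E * q * m + E * q\<^sup>2)"
        using \<sigma>_le l(2) by (intro mult_left_mono) auto
      moreover have "E * (4 * q * (y \<bullet> V) - \<gamma> * q\<^sup>2) \<le> E * (4 * q * (m * norm V) - \<gamma> * q\<^sup>2)"
        using E q norm_cauchy_schwarz[of y V] by (simp add: m_def)
      ultimately have "E * (8 * l * m\<^sup>2 - \<kappa> * (4 * q + 4 * q * m + q\<^sup>2) - 4 * q * m * norm V + \<gamma> * q\<^sup>2) \<le> 0"
        by (simp add: algebra_simps)
      moreover have "0 < 8 * l * m\<^sup>2 - \<kappa> * (4 * q + 4 * q * m + q\<^sup>2) - 4 * q * m * norm V + \<gamma> * q\<^sup>2"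
        using m(1) q(1) by (intro rate) (auto simp: q_def)
      ultimately show False
        using E(1) by (simp add: mult_le_0_iff)
    qed
  qed
qed

text \<open>Comparison in the slanted cylinder \<open>D\<close> around the segment from \<open>z1\<close> to \<open>z0\<close>.  The lower barrier is the bump
  minus the constant \<open>c0\<close>, the value of its peak at the time \<open>tend\<close>: it is therefore nonpositive on the lid
  \<open>t = tend\<close> as well as on the lateral boundary, but positive at \<open>z0\<close>, which is reached before \<open>tend\<close>.
  So a negative minimum of \<open>u - v\<close> minus the barrier lies neither on the lid nor on the sides, and not on
  the bottom, where \<open>u - v > c\<close>.  Letting the cylinder extend beyond the time of \<open>z0\<close> makes the minimum local in
  \<open>A\<close>, where later points exist; if \<open>z0\<close> is at the final time, \<open>D\<close> is simply cut off at \<open>T\<close>.\<close>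

lemma positive_gap_propagates_forward:
  assumes r: "cball z0 r \<inter> {w. snd w \<le> T} \<subseteq> A" and z0: "z0 \<in> A"
    and z1: "z1 \<in> A" "dist z1 z0 < r" "snd z1 < snd z0" and pos: "v z1 < u z1"
  shows "v z0 < u z0"
proof (rule ccontr)
  assume "\<not> ?thesis"
  then have zero: "u z0 = v z0" using v_le_u[OF z0] by simp
  define K where "K = cball z0 r \<inter> {w. snd w \<le> T}"
  have "closed {w :: 'n spacetime. snd w \<le> T}"
    by (intro closed_Collect_le continuous_intros)
  then have K: "compact K" "K \<subseteq> A"
    using r unfolding K_def by (auto intro: compact_Int_closed)
  define t1 t0 where "t1 = snd z1" and "t0 = snd z0"
  define V where "V = (fst z0 - fst z1) /\<^sub>R (t0 - t1)"
  \<comment> \<open>The lid is as far beyond \<open>z0\<close> in time as \<open>z1\<close> is before it, so that the axis stays within \<open>dist z1 z0\<close> of \<open>z0\<close>.\<close>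
  define tend where "tend = 2 * t0 - t1"
  have t: "t1 < t0" "t0 < tend" "tend - t0 = t0 - t1" using z1(3) by (simp_all add: t1_def t0_def tend_def)
  define Y where "Y = (\<lambda>w :: 'n spacetime. fst w - fst z1 - (snd w - t1) *\<^sub>R V)"
  have V: "(t0 - t1) *\<^sub>R V = fst z0 - fst z1" using t by (simp add: V_def)
  define c where "c = (u z1 - v z1) / 2"
  have c: "0 < c" "c < u z1 - v z1" using pos by (simp_all add: c_def)
  obtain s where s: "s > 0" "\<And>w. w \<in> A \<Longrightarrow> dist w z1 < s \<Longrightarrow> c < u w - v w"
    using gap_lower_bound_near[OF z1(1) c(2)] by blast
  define R where "R = min (min 1 (s / 2)) (r - dist z1 z0)"
  have R: "0 < R" "R \<le> 1" "R < s" "R \<le> r - dist z1 z0"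
    using s(1) z1(2) by (auto simp: R_def)
  obtain \<gamma> \<epsilon>\<^sub>0 where \<gamma>: "\<gamma> > 0" "\<epsilon>\<^sub>0 > 0" and no_touch:
    "\<And>\<epsilon> a t1 k U z. 0 < \<epsilon> \<Longrightarrow> \<epsilon> \<le> \<epsilon>\<^sub>0 \<Longrightarrow> open U \<Longrightarrow> z \<in> U \<Longrightarrow> z \<in> K \<Longrightarrow> t1 \<le> snd z \<Longrightarrow>
      norm (fst z - a - (snd z - t1) *\<^sub>R V) < R \<Longrightarrow>
      (\<And>w. w \<in> A \<inter> U \<Longrightarrow> v w + (moving_bump \<epsilon> \<gamma> R a V t1 w + k) \<le> u w) \<Longrightarrow>
      v z + (moving_bump \<epsilon> \<gamma> R a V t1 z + k) = u z \<Longrightarrow>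
      moving_bump \<epsilon> \<gamma> R a V t1 z < u z - v z"
    using gap_exceeds_touching_bump[OF K R(1,2), where V = V] by blast
  define \<epsilon> where "\<epsilon> = min c \<epsilon>\<^sub>0"
  have \<epsilon>: "0 < \<epsilon>" "\<epsilon> \<le> c" "\<epsilon> \<le> \<epsilon>\<^sub>0" using c \<gamma> by (auto simp: \<epsilon>_def)
  define h where "h = moving_bump \<epsilon> \<gamma> R (fst z1) V t1"
  have h_eq: "h w = \<epsilon> * exp (- \<gamma> * (snd w - t1)) * (R\<^sup>2 - (norm (Y w))\<^sup>2)\<^sup>2" for w
    by (simp add: h_def moving_bump_def Y_def)
  define c0 where "c0 = \<epsilon> * exp (- \<gamma> * (tend - t1)) * (R\<^sup>2)\<^sup>2"
  have c0: "0 < c0" using \<epsilon> R by (simp add: c0_def)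
  define D where "D = {w. snd w \<le> T \<and> t1 \<le> snd w \<and> snd w \<le> tend \<and> norm (Y w) \<le> R}"
  have contY: "continuous_on X Y" for X
    unfolding Y_def by (intro continuous_intros)
  have "closed D"
    unfolding D_def by (intro closed_Collect_conj closed_Collect_le continuous_intros contY)
  have D_K: "D \<subseteq> K"
  proof
    fix w assume w: "w \<in> D"
    have split: "w - z0 = (Y w, 0) + (snd w - t0) *\<^sub>R (V, 1)"
    proof (rule prod_eqI)
      have "(snd w - t1) *\<^sub>R V = (snd w - t0) *\<^sub>R V + (t0 - t1) *\<^sub>R V"
        by (simp flip: scaleR_left_distrib)
      then show "fst (w - z0) = fst ((Y w, 0) + (snd w - t0) *\<^sub>R (V, 1))"
        by (simp add: Y_def V)
    qed (simp add: t0_def)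
    have "norm (w - z0) \<le> norm (Y w, 0 :: real) + norm ((snd w - t0) *\<^sub>R (V, 1 :: real))"
      unfolding split by (rule norm_triangle_ineq)
    also have "\<dots> = norm (Y w) + \<bar>snd w - t0\<bar> * norm (V, 1 :: real)"
      unfolding norm_scaleR by (simp add: norm_Pair)
    also have "\<dots> \<le> R + (t0 - t1) * norm (V, 1 :: real)"
      using w t by (intro add_mono mult_right_mono) (auto simp: D_def)
    also have "(t0 - t1) * norm (V, 1 :: real) = norm ((t0 - t1) *\<^sub>R (V, 1 :: real))"
      unfolding norm_scaleR using t(1) by simp
    also have "(t0 - t1) *\<^sub>R (V, 1 :: real) = z0 - z1"
      by (rule prod_eqI) (use V in \<open>simp_all add: t0_def t1_def\<close>)
    also have "R + norm (z0 - z1) \<le> r"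
      using R(4) by (simp add: dist_norm norm_minus_commute)
    finally show "w \<in> K"
      using w by (auto simp: K_def D_def dist_norm norm_minus_commute)
  qed
  have "compact D"
    using compact_Int_closed[OF K(1) \<open>closed D\<close>] D_K by (simp add: Int_absorb1)
  have Y0: "Y z0 = 0"
    using V by (simp add: Y_def t0_def)
  have z0D: "z0 \<in> D"
    using Y0 R t rel_open_top[OF rel_open z0] by (simp add: D_def t0_def)
  have D_A: "D \<subseteq> A" using D_K K(2) by blast
  have "continuous_on D h"
    unfolding h_eq[abs_def] by (intro continuous_intros contY)
  then have "lower_semicontinuous_on D (\<lambda>w. (u w + - v w) + - h w)"
    by (intro lower_semicontinuous_on_add_continuous continuous_on_minus
        lower_semicontinuous_on_subset[OF lsc_gap D_A])
  then obtain z where z: "z \<in> D" and min: "\<And>w. w \<in> D \<Longrightarrow> (u z + - v z) + - h z \<le> (u w + - v w) + - h w"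
    using lower_semicontinuous_attains_min[OF \<open>compact D\<close>] z0D by blast
  have zA: "z \<in> A" and zK: "z \<in> K" using z D_A D_K by auto
  have "c0 < h z0"
    using \<gamma>(1) t \<epsilon>(1) R(1) unfolding h_eq Y0 c0_def by (simp add: t0_def)
  then have gap: "u z - v z < h z - c0"
    using min[OF z0D] zero by simp
  have "0 \<le> u z - v z" using v_le_u[OF zA] by simp
  then have h_pos: "c0 < h z" using gap by linarith
  have zD: "t1 \<le> snd z" "snd z \<le> tend" "norm (Y z) \<le> R" using z by (auto simp: D_def)
  have q_le: "(R\<^sup>2 - (norm (Y z))\<^sup>2)\<^sup>2 \<le> (R\<^sup>2)\<^sup>2"
    using zD(3) by (intro power_mono) (auto intro: power_mono)
  have side: "norm (Y z) < R"
  proof (rule ccontr)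
    assume "\<not> ?thesis"
    then have "norm (Y z) = R" using zD(3) by simp
    then show False using h_pos c0 by (simp add: h_eq)
  qed
  have top: "snd z < tend"
  proof (rule ccontr)
    assume "\<not> ?thesis"
    then have "snd z = tend" using zD(2) by simp
    then have "h z \<le> c0"
      unfolding h_eq c0_def using q_le \<epsilon>(1) by (simp add: mult_left_mono)
    then show False using h_pos by simp
  qed
  have bottom: "t1 < snd z"
  proof (rule ccontr)
    assume "\<not> ?thesis"
    then have eq: "snd z = t1" using zD(1) by simp
    then have "dist z z1 = norm (Y z)"
      by (simp add: dist_prod_def Y_def t1_def dist_norm)
    then have "c < u z - v z" using s(2)[OF zA] zD(3) R(3) by simp
    moreover have "h z \<le> \<epsilon>"
    proof -
      have "(R\<^sup>2)\<^sup>2 \<le> 1" using R by (simp add: power_le_one)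
      then have "\<epsilon> * (R\<^sup>2 - (norm (Y z))\<^sup>2)\<^sup>2 \<le> \<epsilon> * 1"
        using q_le \<epsilon>(1) by (intro mult_left_mono) auto
      then show ?thesis by (simp add: h_eq eq)
    qed
    ultimately show False using gap c0 \<epsilon>(2) by linarith
  qed
  define U where "U = {w. t1 < snd w \<and> snd w < tend \<and> norm (Y w) < R}"
  have "open U"
    unfolding U_def by (intro open_Collect_conj open_Collect_less continuous_intros contY)
  have AU: "A \<inter> U \<subseteq> D"
    using rel_open_top[OF rel_open] by (auto simp: U_def D_def)
  have "h z < u z - v z"
    unfolding h_def
  proof (rule no_touch[where U = U and k = "u z - v z - h z"])
    show "z \<in> U" using side top bottom by (simp add: U_def)
    show "norm (fst z - fst z1 - (snd z - t1) *\<^sub>R V) < R" using side by (simp add: Y_def)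
    show "v w + (moving_bump \<epsilon> \<gamma> R (fst z1) V t1 w + (u z - v z - h z)) \<le> u w" if "w \<in> A \<inter> U" for w
      using min[of w] AU that by (auto simp: h_def)
    show "v z + (moving_bump \<epsilon> \<gamma> R (fst z1) V t1 z + (u z - v z - h z)) = u z"
      by (simp add: h_def)
  qed (use \<epsilon> \<open>open U\<close> zK zD in auto)
  then show False using gap c0 by linarith
qed

text \<open>Strictly earlier points are covered by the previous lemma.  If the gap were positive at a point with the same time as
  \<open>z0\<close>, it would be positive slightly below it by lower semicontinuity, contradicting that case.\<close>

lemma zero_gap_spreads_backward:
  assumes z0: "z0 \<in> A" and zero: "u z0 = v z0"
  obtains r where "r > 0" "\<And>z. z \<in> A \<Longrightarrow> dist z z0 < r \<Longrightarrow> snd z \<le> snd z0 \<Longrightarrow> u z = v z"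
proof -
  obtain r where r: "r > 0" "cball z0 r \<inter> {w. snd w \<le> T} \<subseteq> A"
    using rel_open_half_ball[OF rel_open z0] .
  have earlier: "u z = v z" if "z \<in> A" "dist z z0 < r" "snd z < snd z0" for z
    using positive_gap_propagates_forward[OF r(2) z0 that] v_le_u[OF that(1)] zero
    by (cases "v z < u z") auto
  have "u z = v z" if z: "z \<in> A" "dist z z0 < r" "snd z \<le> snd z0" for z
  proof (rule ccontr)
    assume "u z \<noteq> v z"
    then have pos: "0 < u z - v z" using v_le_u[OF z(1)] by simp
    obtain s where s: "s > 0" "\<And>w. w \<in> A \<Longrightarrow> dist w z < s \<Longrightarrow> 0 < u w - v w"
      using gap_lower_bound_near[OF z(1) pos] by blast
    define \<tau> where "\<tau> = min s (r - dist z z0) / 2"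
    have \<tau>: "0 < \<tau>" "\<tau> < s" "\<tau> < r - dist z z0" using s(1) z(2) by (auto simp: \<tau>_def)
    define w where "w = (fst z, snd z - \<tau>)"
    have dwz: "dist w z = \<tau>" using \<tau>(1) by (simp add: w_def dist_prod_def dist_real_def)
    then have dw: "dist w z0 < r" using dist_triangle[of w z0 z] \<tau>(3) by linarith
    moreover have "w \<in> A"
      using r(2) dw rel_open_top[OF rel_open z(1)] \<tau>(1) by (auto simp: w_def dist_commute)
    moreover have "snd w < snd z0" using z(3) \<tau>(1) by (simp add: w_def)
    ultimately show False
      using earlier[of w] s(2)[of w] dwz \<tau>(2) by simp
  qed
  then show ?thesis using that[OF r(1)] by blast
qed

text \<open>Let \<open>\<theta>\<close> be the supremum of the parameters at which the gap is positive.  By lower semicontinuity the gap vanishes at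
  \<open>g \<theta>\<close>, hence, as time is monotone along \<open>g\<close>, also at all parameters slightly below \<open>\<theta>\<close>.\<close>

lemma zero_gap_along_path:
  assumes g: "path g" "path_image g \<subseteq> A" and mono: "mono_on {0..1} (\<lambda>\<theta>. snd (g \<theta>))"
    and zero: "u (pathfinish g) = v (pathfinish g)"
  shows "u (pathstart g) = v (pathstart g)"
proof (rule ccontr)
  assume start: "\<not> ?thesis"
  have gA: "g \<theta> \<in> A" if "\<theta> \<in> {0..1}" for \<theta>
    using g(2) that by (auto simp: path_image_def)
  have cont: "\<exists>d>0. \<forall>\<theta>'\<in>{0..1}. \<bar>\<theta>' - \<theta>\<bar> < d \<longrightarrow> dist (g \<theta>') (g \<theta>) < e"
    if "\<theta> \<in> {0..1}" "e > 0" for \<theta> e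
    using g(1) that unfolding path_def continuous_on_iff dist_real_def by blast
  define N where "N = {\<theta> \<in> {0..1}. u (g \<theta>) \<noteq> v (g \<theta>)}"
  define \<theta> where "\<theta> = Sup N"
  have N: "0 \<in> N" "bdd_above N"
    using start by (simp add: N_def pathstart_def, intro bdd_aboveI[of _ 1]) (simp add: N_def)
  have upper: "\<theta>' \<le> \<theta>" if "\<theta>' \<in> N" for \<theta>'
    using cSup_upper[OF that N(2)] by (simp add: \<theta>_def)
  have \<theta>: "\<theta> \<in> {0..1}"
  proof -
    have "Sup N \<le> 1"
    proof (rule cSup_least)
      show "N \<noteq> {}" using N(1) by blast
    qed (simp add: N_def)
    then show ?thesis using upper[OF N(1)] by (simp add: \<theta>_def)
  qed
  have \<theta>_zero: "u (g \<theta>) = v (g \<theta>)"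
  proof (rule ccontr)
    assume ne: "u (g \<theta>) \<noteq> v (g \<theta>)"
    then have "\<theta> \<noteq> 1" using zero by (auto simp: pathfinish_def)
    have "0 < u (g \<theta>) - v (g \<theta>)" using ne v_le_u[OF gA[OF \<theta>]] by simp
    then obtain s where s: "s > 0" "\<And>w. w \<in> A \<Longrightarrow> dist w (g \<theta>) < s \<Longrightarrow> 0 < u w - v w"
      using gap_lower_bound_near[OF gA[OF \<theta>]] by blast
    obtain d where d: "d > 0" "\<forall>\<theta>'\<in>{0..1}. \<bar>\<theta>' - \<theta>\<bar> < d \<longrightarrow> dist (g \<theta>') (g \<theta>) < s"
      using cont[OF \<theta> s(1)] by blast
    define \<theta>' where "\<theta>' = min 1 (\<theta> + d / 2)"
    have \<theta>': "\<theta>' \<in> {0..1}" "\<theta> < \<theta>'" "\<bar>\<theta>' - \<theta>\<bar> < d"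
      using \<theta> \<open>\<theta> \<noteq> 1\<close> d(1) by (auto simp: \<theta>'_def min_def)
    have "0 < u (g \<theta>') - v (g \<theta>')"
      by (rule s(2)[OF gA[OF \<theta>'(1)] d(2)[rule_format, OF \<theta>'(1,3)]])
    then have "\<theta>' \<in> N" using \<theta>'(1) by (simp add: N_def)
    then show False using upper[of \<theta>'] \<theta>'(2) by simp
  qed
  obtain r where r: "r > 0" "\<And>z. z \<in> A \<Longrightarrow> dist z (g \<theta>) < r \<Longrightarrow> snd z \<le> snd (g \<theta>) \<Longrightarrow> u z = v z"
    using zero_gap_spreads_backward[OF gA[OF \<theta>] \<theta>_zero] by blast
  obtain d where d: "d > 0" "\<forall>\<theta>'\<in>{0..1}. \<bar>\<theta>' - \<theta>\<bar> < d \<longrightarrow> dist (g \<theta>') (g \<theta>) < r"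
    using cont[OF \<theta> r(1)] by blast
  obtain \<theta>' where \<theta>': "\<theta>' \<in> N" "\<theta> - d < \<theta>'"
    using less_cSupD[of N "\<theta> - d"] N(1) d(1) unfolding \<theta>_def by auto
  have \<theta>'_le: "\<theta>' \<le> \<theta>" by (rule upper[OF \<theta>'(1)])
  have \<theta>'_in: "\<theta>' \<in> {0..1}" using \<theta>'(1) by (simp add: N_def)
  have "dist (g \<theta>') (g \<theta>) < r"
    using \<theta>'(2) \<theta>'_le d(1) by (intro d(2)[rule_format, OF \<theta>'_in]) linarith
  moreover have "snd (g \<theta>') \<le> snd (g \<theta>)" using mono_onD[OF mono \<theta>'_in \<theta> \<theta>'_le] .
  ultimately have "u (g \<theta>') = v (g \<theta>')" by (intro r(2) gA[OF \<theta>'_in])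
  then show False using \<theta>'(1) by (simp add: N_def)
qed

end

theorem theorem4p1:
  fixes \<Omega> S :: "((real ^ 'n) \<times> real) set"
    and T :: real
    and F :: "(real ^ 'n) \<times> real \<Rightarrow> real \<Rightarrow> real ^ 'n \<Rightarrow> real ^ 'n ^ 'n \<Rightarrow> real"
    and u v :: "(real ^ 'n) \<times> real \<Rightarrow> real"
    and P :: "(real ^ 'n) \<times> real"
  assumes "bounded \<Omega>" and "connected \<Omega>" and "open \<Omega>"
    and "\<Omega> \<subseteq> {z. snd z < T}"
    and "flat_top_portion \<Omega> T S"
    and "continuous_operator (closure \<Omega>) F"
    and "C1_operator (closure \<Omega>) F"
    and "elliptic_operator (closure \<Omega>) F"
    and "\<forall>z \<in> closure \<Omega>. v z \<le> u z"
    and "lower_semicontinuous_on (closure \<Omega>) u"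
    and "C2_on (\<Omega> \<union> S) v"
    and "viscosity_ineq_on (\<Omega> \<union> S) F u v"
    and "P \<in> S" and "u P = v P"
  shows "\<forall>z \<in> C_set \<Omega> S P \<union> S_set \<Omega> S P. u z = v z"
proof -
  have sub: "\<Omega> \<union> S \<subseteq> closure \<Omega>"
    using assms(5) closure_subset by (auto simp: flat_top_portion_def frontier_def)
  then have dom: "operator_domain (\<Omega> \<union> S) \<subseteq> operator_domain (closure \<Omega>)"
    by (auto simp: operator_domain_def)
  interpret touching_supersolution "\<Omega> \<union> S" T F u v
  proof
    show "openin (top_of_set {z. snd z \<le> T}) (\<Omega> \<union> S)"
      using assms(5) by (simp add: flat_top_portion_def)
    show "continuous_operator (\<Omega> \<union> S) F"
      using assms(6) continuous_on_subset[OF _ dom] by (simp add: continuous_operator_def)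
    show "C1_operator (\<Omega> \<union> S) F"
    proof -
      note C1 = assms(7)[unfolded C1_operator_def]
      show ?thesis
        unfolding C1_operator_def
        by (intro conjI ballI bspec[OF conjunct1[OF C1] subsetD[OF dom]]
            continuous_on_subset[OF _ dom] C1[THEN conjunct2, THEN conjunct1]
            C1[THEN conjunct2, THEN conjunct2, THEN conjunct1]
            C1[THEN conjunct2, THEN conjunct2, THEN conjunct2])
    qed
    show "elliptic_operator (\<Omega> \<union> S) F"
      unfolding elliptic_operator_def
      by (rule ballI) (rule bspec[OF assms(8)[unfolded elliptic_operator_def] subsetD[OF dom]])
    show "v z \<le> u z" if "z \<in> \<Omega> \<union> S" for z
      using assms(9) sub that by blast
    show "lower_semicontinuous_on (\<Omega> \<union> S) u"
      using assms(10) sub by (rule lower_semicontinuous_on_subset)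
  qed (rule assms)+
  have "u z = v z" if "z \<in> C_set \<Omega> S P" for z
  proof -
    have "path_component {z \<in> \<Omega> \<union> S. snd z = snd P} z P"
      using that by (simp add: C_set_def path_component_sym)
    then obtain g where g: "path g" "path_image g \<subseteq> {z \<in> \<Omega> \<union> S. snd z = snd P}"
      "pathstart g = z" "pathfinish g = P"
      unfolding path_component_def by blast
    have "snd (g \<theta>) = snd P" if "\<theta> \<in> {0..1}" for \<theta>
    proof -
      have "g \<theta> \<in> path_image g" using that by (simp add: path_image_def)
      then show ?thesis using g(2) by blast
    qed
    then have "mono_on {0..1} (\<lambda>\<theta>. snd (g \<theta>))"
      by (simp add: mono_on_def)
    moreover have "path_image g \<subseteq> \<Omega> \<union> S" using g(2) by blast
    ultimately show ?thesis
      using zero_gap_along_path[OF g(1)] g(3,4) assms(14) by simp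
  qed
  moreover have "u z = v z" if "z \<in> S_set \<Omega> S P" for z
  proof -
    have "\<exists>g. path g \<and> path_image g \<subseteq> \<Omega> \<union> S \<and> pathstart g = z \<and> pathfinish g = P
        \<and> mono_on {0..1} (\<lambda>\<theta>. snd (g \<theta>))"
      using that by (simp add: S_set_def)
    then obtain g where g: "path g" "path_image g \<subseteq> \<Omega> \<union> S" "pathstart g = z" "pathfinish g = P"
      "mono_on {0..1} (\<lambda>\<theta>. snd (g \<theta>))"
      by (elim exE conjE)
    show ?thesis
      using zero_gap_along_path[OF g(1,2,5)] g(3,4) assms(14) by simp
  qed
  ultimately show ?thesis by blast
qed

end
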